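(* Let $R$ be a finite-dimensional algebra over a field $K$ such that there exists an isomorphism of $R$-bimodules $\psi:R^*\otimes_R R^*\to R$. Then $A=R\rtimes_\psi R^*$ is a symmetric algebra and a strongly $C_2$-graded algebra with grading given by $A_e=R\times 0$ and $A_c=0\times R^*$, where $C_2=\{e,c\}$ is the cyclic group of order $2$ with neutral element $e$.
   Context: Algebras are associative and unital. For a finite-dimensional $K$-algebra $A$, $A^*=\mathrm{Hom}_K(A,K)$ is an $A$-bimodule by $(r\rightharpoonup r^* )(a)=r^*(ar)$ and $(r^*\leftharpoonup r)(a)=r^*(ra)$. $A$ is symmetric if $A\simeq A^*$ as $A$-bimodules. For a group $G$, a $G$-graded algebra $A=\oplus_{g\in G}A_g$ (with $A_gA_h\subset A_{gh}$) is strongly graded if $A_gA_h=A_{gh}$ for all $g,h\in G$. $R\rtimes_\psi R^*$ denotes the semitrivial extension: the vector space $R\times R^*$ with multiplication $(r,r^* )(s,s^* )=(rs+\psi(r^*\otimes_R s^* ),\,(r\rightharpoonup s^* )+(r^*\leftharpoonup s))$. (It is part of the assertion that this multiplication is associative, i.e. that $A$ is an algebra, with identity $(1,0)$.) *)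

theory Defs
  imports
    "Jordan_Normal_Form.Missing_VectorSpace"
    "HOL-Algebra.Free_Abelian_Groups"
begin

section \<open>Algebras over a field\<close>

text \<open>
  The locale \<open>algebra\<close> of HOL-Algebra is restricted to commutative algebras, so the notion of an
  associative unital algebra is introduced here. The zero algebra is allowed.
\<close>

locale assoc_algebra = vectorspace K A + ring A for K and A (structure) +
  assumes smult_mult_left:
    "\<lbrakk>k \<in> carrier K; x \<in> carrier A; y \<in> carrier A\<rbrakk>
      \<Longrightarrow> (k \<odot>\<^bsub>A\<^esub> x) \<otimes>\<^bsub>A\<^esub> y = k \<odot>\<^bsub>A\<^esub> (x \<otimes>\<^bsub>A\<^esub> y)"
    and smult_mult_right:
    "\<lbrakk>k \<in> carrier K; x \<in> carrier A; y \<in> carrier A\<rbrakk>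
      \<Longrightarrow> x \<otimes>\<^bsub>A\<^esub> (k \<odot>\<^bsub>A\<^esub> y) = k \<odot>\<^bsub>A\<^esub> (x \<otimes>\<^bsub>A\<^esub> y)"

locale fin_dim_algebra = assoc_algebra K A for K and A (structure) +
  assumes finite_dimensional: "vectorspace.fin_dim K A"


section \<open>Bimodules\<close>

text \<open>
  As for modules in HOL-Algebra, the record extends \<open>ring\<close>; its fields \<open>mult\<close> and \<open>one\<close> are not used.
\<close>

record ('a, 'b) bimodule = "'b ring" +
  lact :: "'a \<Rightarrow> 'b \<Rightarrow> 'b"
  ract :: "'b \<Rightarrow> 'a \<Rightarrow> 'b"

locale bimodule = R?: ring R + M?: abelian_group M
  for R :: "('a, 'r) ring_scheme" and M :: "('a, 'm, 'x) bimodule_scheme" (structure) +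
  assumes lact_closed:
    "\<lbrakk>r \<in> carrier R; x \<in> carrier M\<rbrakk> \<Longrightarrow> lact M r x \<in> carrier M"
    and ract_closed:
    "\<lbrakk>r \<in> carrier R; x \<in> carrier M\<rbrakk> \<Longrightarrow> ract M x r \<in> carrier M"
    and lact_add_left:
    "\<lbrakk>r \<in> carrier R; s \<in> carrier R; x \<in> carrier M\<rbrakk>
      \<Longrightarrow> lact M (r \<oplus>\<^bsub>R\<^esub> s) x = lact M r x \<oplus>\<^bsub>M\<^esub> lact M s x"
    and lact_add_right:
    "\<lbrakk>r \<in> carrier R; x \<in> carrier M; y \<in> carrier M\<rbrakk>
      \<Longrightarrow> lact M r (x \<oplus>\<^bsub>M\<^esub> y) = lact M r x \<oplus>\<^bsub>M\<^esub> lact M r y"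
    and ract_add_left:
    "\<lbrakk>r \<in> carrier R; x \<in> carrier M; y \<in> carrier M\<rbrakk>
      \<Longrightarrow> ract M (x \<oplus>\<^bsub>M\<^esub> y) r = ract M x r \<oplus>\<^bsub>M\<^esub> ract M y r"
    and ract_add_right:
    "\<lbrakk>r \<in> carrier R; s \<in> carrier R; x \<in> carrier M\<rbrakk>
      \<Longrightarrow> ract M x (r \<oplus>\<^bsub>R\<^esub> s) = ract M x r \<oplus>\<^bsub>M\<^esub> ract M x s"
    and lact_assoc:
    "\<lbrakk>r \<in> carrier R; s \<in> carrier R; x \<in> carrier M\<rbrakk>
      \<Longrightarrow> lact M (r \<otimes>\<^bsub>R\<^esub> s) x = lact M r (lact M s x)"
    and ract_assoc:
    "\<lbrakk>r \<in> carrier R; s \<in> carrier R; x \<in> carrier M\<rbrakk>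
      \<Longrightarrow> ract M x (r \<otimes>\<^bsub>R\<^esub> s) = ract M (ract M x r) s"
    and lact_ract:
    "\<lbrakk>r \<in> carrier R; s \<in> carrier R; x \<in> carrier M\<rbrakk>
      \<Longrightarrow> ract M (lact M r x) s = lact M r (ract M x s)"
    and lact_one: "x \<in> carrier M \<Longrightarrow> lact M \<one>\<^bsub>R\<^esub> x = x"
    and ract_one: "x \<in> carrier M \<Longrightarrow> ract M x \<one>\<^bsub>R\<^esub> = x"

definition bimodule_hom ::
  "('a, 'r) ring_scheme \<Rightarrow> ('a, 'm, 'x) bimodule_scheme \<Rightarrow> ('a, 'n, 'y) bimodule_scheme \<Rightarrow> ('m \<Rightarrow> 'n) set"
  where "bimodule_hom R M N =
    {f \<in> carrier M \<rightarrow> carrier N.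
      (\<forall>x\<in>carrier M. \<forall>y\<in>carrier M. f (x \<oplus>\<^bsub>M\<^esub> y) = f x \<oplus>\<^bsub>N\<^esub> f y) \<and>
      (\<forall>r\<in>carrier R. \<forall>x\<in>carrier M. f (lact M r x) = lact N r (f x)) \<and>
      (\<forall>r\<in>carrier R. \<forall>x\<in>carrier M. f (ract M x r) = ract N (f x) r)}"

definition bimodule_iso ::
  "('a, 'r) ring_scheme \<Rightarrow> ('a, 'm, 'x) bimodule_scheme \<Rightarrow> ('a, 'n, 'y) bimodule_scheme \<Rightarrow> ('m \<Rightarrow> 'n) set"
  where "bimodule_iso R M N = {f \<in> bimodule_hom R M N. bij_betw f (carrier M) (carrier N)}"

definition regular_bimodule :: "('a, 'r) ring_scheme \<Rightarrow> ('a, 'a) bimodule"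
  where "regular_bimodule R =
    \<lparr>carrier = carrier R, mult = undefined, one = undefined, ring.zero = \<zero>\<^bsub>R\<^esub>, add = add R,
     lact = mult R, ract = mult R\<rparr>"

text \<open>
  \<open>Hom\<^sub>K(A, K)\<close>; functionals are extensional, i.e. take the value \<open>undefined\<close> outside the carrier of
  \<open>A\<close>, so that equality of functionals is equality on \<open>A\<close>.
\<close>

definition dual :: "('k, 'c) ring_scheme \<Rightarrow> ('k, 'a, 'd) module_scheme \<Rightarrow> ('a, 'a \<Rightarrow> 'k) bimodule"
  where "dual K A =
    \<lparr>carrier =
       {f \<in> carrier A \<rightarrow>\<^sub>E carrier K.
         (\<forall>x\<in>carrier A. \<forall>y\<in>carrier A. f (x \<oplus>\<^bsub>A\<^esub> y) = f x \<oplus>\<^bsub>K\<^esub> f y) \<and>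
         (\<forall>k\<in>carrier K. \<forall>x\<in>carrier A. f (k \<odot>\<^bsub>A\<^esub> x) = k \<otimes>\<^bsub>K\<^esub> f x)},
     mult = undefined, one = undefined,
     ring.zero = (\<lambda>a\<in>carrier A. \<zero>\<^bsub>K\<^esub>),
     add = (\<lambda>f g. \<lambda>a\<in>carrier A. f a \<oplus>\<^bsub>K\<^esub> g a),
     lact = (\<lambda>r f. \<lambda>a\<in>carrier A. f (a \<otimes>\<^bsub>A\<^esub> r)),
     ract = (\<lambda>f r. \<lambda>a\<in>carrier A. f (r \<otimes>\<^bsub>A\<^esub> a))\<rparr>"

lemma dual_bimodule:
  assumes "assoc_algebra K A"
  shows "bimodule A (dual K A)"
proof -
  interpret A: assoc_algebra K A by fact
  have ab: "abelian_group (dual K A)"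
  proof (rule abelian_groupI)
    fix f assume f: "f \<in> carrier (dual K A)"
    show "\<exists>g\<in>carrier (dual K A). g \<oplus>\<^bsub>dual K A\<^esub> f = \<zero>\<^bsub>dual K A\<^esub>"
      using f
      by (intro bexI[of _ "\<lambda>a\<in>carrier A. \<ominus>\<^bsub>K\<^esub> f a"])
        (auto simp: dual_def PiE_iff A.R.l_neg A.R.r_minus A.R.minus_add intro!: restrict_ext)
  qed (auto simp: dual_def PiE_iff extensional_def A.R.a_ac A.R.r_distr intro!: ext)
  show ?thesis
    by (intro bimodule.intro bimodule_axioms.intro ab)
      (auto simp: dual_def PiE_iff A.ring_axioms A.l_distr A.r_distr A.m_assoc
        A.smult_mult_left A.smult_mult_right extensional_def intro!: ext)
qed

definition symmetric_algebra :: "('k, 'c) ring_scheme \<Rightarrow> ('k, 'a, 'd) module_scheme \<Rightarrow> bool"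
  where "symmetric_algebra K A \<longleftrightarrow>
    fin_dim_algebra K A \<and> (\<exists>f. f \<in> bimodule_iso A (regular_bimodule A) (dual K A))"


section \<open>The tensor product over a noncommutative ring\<close>

text \<open>
  \<open>M \<otimes>\<^sub>R N\<close> is the free abelian group on the set of pairs modulo biadditivity and
  \<open>(m r, n) = (m, r n)\<close>. Its elements are cosets.
\<close>

definition tensor_relators ::
  "('a, 'r) ring_scheme \<Rightarrow> ('a, 'm, 'x) bimodule_scheme \<Rightarrow> ('a, 'n, 'y) bimodule_scheme
    \<Rightarrow> (('m \<times> 'n) \<Rightarrow>\<^sub>0 int) set"
  where "tensor_relators R M N =
    {frag_of (m \<oplus>\<^bsub>M\<^esub> m', n) - frag_of (m, n) - frag_of (m', n) | m m' n.
      m \<in> carrier M \<and> m' \<in> carrier M \<and> n \<in> carrier N} \<union>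
    {frag_of (m, n \<oplus>\<^bsub>N\<^esub> n') - frag_of (m, n) - frag_of (m, n') | m n n'.
      m \<in> carrier M \<and> n \<in> carrier N \<and> n' \<in> carrier N} \<union>
    {frag_of (ract M m r, n) - frag_of (m, lact N r n) | m r n.
      m \<in> carrier M \<and> r \<in> carrier R \<and> n \<in> carrier N}"

abbreviation tensor_free ::
  "('a, 'm, 'x) bimodule_scheme \<Rightarrow> ('a, 'n, 'y) bimodule_scheme \<Rightarrow> (('m \<times> 'n) \<Rightarrow>\<^sub>0 int) monoid"
  where "tensor_free M N \<equiv> free_Abelian_group (carrier M \<times> carrier N)"

definition tensor_kernel ::
  "('a, 'r) ring_scheme \<Rightarrow> ('a, 'm, 'x) bimodule_scheme \<Rightarrow> ('a, 'n, 'y) bimodule_scheme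
    \<Rightarrow> (('m \<times> 'n) \<Rightarrow>\<^sub>0 int) set"
  where "tensor_kernel R M N = generate (tensor_free M N) (tensor_relators R M N)"

definition tensor_class ::
  "('a, 'r) ring_scheme \<Rightarrow> ('a, 'm, 'x) bimodule_scheme \<Rightarrow> ('a, 'n, 'y) bimodule_scheme
    \<Rightarrow> (('m \<times> 'n) \<Rightarrow>\<^sub>0 int) \<Rightarrow> (('m \<times> 'n) \<Rightarrow>\<^sub>0 int) set"
  where "tensor_class R M N x = tensor_kernel R M N #>\<^bsub>tensor_free M N\<^esub> x"

definition elem_tensor ::
  "('a, 'r) ring_scheme \<Rightarrow> ('a, 'm, 'x) bimodule_scheme \<Rightarrow> ('a, 'n, 'y) bimodule_scheme
    \<Rightarrow> 'm \<Rightarrow> 'n \<Rightarrow> (('m \<times> 'n) \<Rightarrow>\<^sub>0 int) set"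
  where "elem_tensor R M N m n = tensor_class R M N (frag_of (m, n))"

text \<open>
  The actions \<open>r (m \<otimes> n) = (r m) \<otimes> n\<close> and \<open>(m \<otimes> n) r = m \<otimes> (n r)\<close> are induced by additive maps of
  the free abelian group. All members of a coset \<open>X\<close> have the same image class, so the union over \<open>X\<close>
  is that class.
\<close>

definition tensor ::
  "('a, 'r) ring_scheme \<Rightarrow> ('a, 'm, 'x) bimodule_scheme \<Rightarrow> ('a, 'n, 'y) bimodule_scheme
    \<Rightarrow> ('a, (('m \<times> 'n) \<Rightarrow>\<^sub>0 int) set) bimodule"
  where "tensor R M N =
    \<lparr>carrier = carrier (tensor_free M N Mod tensor_kernel R M N),
     mult = undefined, one = undefined,
     ring.zero = \<one>\<^bsub>tensor_free M N Mod tensor_kernel R M N\<^esub>,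
     add = mult (tensor_free M N Mod tensor_kernel R M N),
     lact = (\<lambda>r X. \<Union>x\<in>X. tensor_class R M N (frag_extend (\<lambda>(m, n). frag_of (lact M r m, n)) x)),
     ract = (\<lambda>X r. \<Union>x\<in>X. tensor_class R M N (frag_extend (\<lambda>(m, n). frag_of (m, ract N n r)) x))\<rparr>"

lemma tensor_kernel_stable:
  assumes F: "\<And>x y. \<phi> (x + y) = \<phi> x + \<phi> y" "\<And>x. \<phi> (- x) = - \<phi> x" "\<phi> 0 = 0"
    and rel: "\<And>x. x \<in> tensor_relators R M N \<Longrightarrow> \<phi> x \<in> tensor_relators R M N"
    and sub: "tensor_relators R M N \<subseteq> carrier (tensor_free M N)"
    and h: "h \<in> tensor_kernel R M N"
  shows "\<phi> h \<in> tensor_kernel R M N"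
  using h unfolding tensor_kernel_def
proof (induction rule: generate.induct)
  case one then show ?case using F by (simp add: free_Abelian_group_def) (metis free_Abelian_group_def generate.one monoid.select_convs(2))
next
  case (incl h) then show ?case by (simp add: generate.incl rel)
next
  case (inv h)
  have "h \<in> carrier (tensor_free M N)" "\<phi> h \<in> carrier (tensor_free M N)" using inv rel sub by blast+
  then show ?case using generate.inv[OF rel[OF inv], of "tensor_free M N"] by (simp add: F)
next
  case (eng h1 h2) then show ?case by (simp add: F) (metis generate.eng mult_free_Abelian_group)
qed

lemma tensor_relators_subset:
  assumes "bimodule R M" "bimodule R N"
  shows "tensor_relators R M N \<subseteq> carrier (tensor_free M N)"
proof -
  interpret M: bimodule R M by fact
  interpret N: bimodule R N by fact
  show ?thesis
    unfolding tensor_relators_def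
    by (auto simp: M.ract_closed N.lact_closed dest!: subsetD[OF keys_diff])
qed

lemma tensor_class_Union:
  assumes M: "bimodule R M" and N: "bimodule R N"
    and F: "\<And>x y. \<phi> (x + y) = \<phi> x + \<phi> y" "\<And>x. \<phi> (- x) = - \<phi> x" "\<phi> 0 = 0"
    and rel: "\<And>x. x \<in> tensor_relators R M N \<Longrightarrow> \<phi> x \<in> tensor_relators R M N"
    and x: "x \<in> carrier (tensor_free M N)" and px: "\<phi> x \<in> carrier (tensor_free M N)"
  shows "(\<Union>y\<in>tensor_class R M N x. tensor_class R M N (\<phi> y)) = tensor_class R M N (\<phi> x)"
proof -
  interpret G: group "tensor_free M N" by simp
  have sub: "subgroup (tensor_kernel R M N) (tensor_free M N)"
    unfolding tensor_kernel_def by (rule G.generate_is_subgroup[OF tensor_relators_subset[OF M N]])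
  then have H: "tensor_kernel R M N \<subseteq> carrier (tensor_free M N)" by (rule subgroup.subset)
  have "tensor_class R M N (\<phi> y) = tensor_class R M N (\<phi> x)" if y: "y \<in> tensor_class R M N x" for y
  proof -
    from y obtain h where h: "h \<in> tensor_kernel R M N" "y = h + x"
      by (auto simp: tensor_class_def r_coset_def)
    have k: "\<phi> h \<in> tensor_kernel R M N"
      by (rule tensor_kernel_stable[OF F rel tensor_relators_subset[OF M N] h(1)])
    have "\<phi> y \<in> tensor_class R M N (\<phi> x)" using k by (auto simp: tensor_class_def r_coset_def h F)
    then show ?thesis unfolding tensor_class_def
      using G.repr_independence[OF _ px sub] by simp
  qed
  moreover have "x \<in> tensor_class R M N x" unfolding tensor_class_def
    by (rule G.rcos_self[OF x sub])
  ultimately show ?thesis by blast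
qed

lemma lact_elem_tensor:
  assumes M: "bimodule R M" and N: "bimodule R N"
    and "r \<in> carrier R" "m \<in> carrier M" "n \<in> carrier N"
  shows "lact (tensor R M N) r (elem_tensor R M N m n) = elem_tensor R M N (lact M r m) n"
proof -
  interpret M: bimodule R M by fact
  interpret N: bimodule R N by fact
  let ?f = "frag_extend (\<lambda>(m, n). frag_of (lact M r m, n))"
  have rel: "?f x \<in> tensor_relators R M N" if "x \<in> tensor_relators R M N" for x
    using that assms(3) unfolding tensor_relators_def
    apply (elim UnE CollectE exE conjE)
      apply (rule UnI1, rule UnI1)
      apply (force simp: frag_extend_diff M.lact_add_right M.lact_closed)
     apply (rule UnI1, rule UnI2)
     apply (force simp: frag_extend_diff M.lact_add_right M.lact_closed)
    apply (rule UnI2)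
    apply (force simp: frag_extend_diff M.lact_ract[symmetric] M.lact_closed)
    done
  show ?thesis
    using tensor_class_Union[OF M N, of ?f "frag_of (m,n)"] rel assms
    by (simp add: tensor_def elem_tensor_def frag_extend_add frag_extend_minus M.lact_closed)
qed

lemma ract_elem_tensor:
  assumes M: "bimodule R M" and N: "bimodule R N"
    and "r \<in> carrier R" "m \<in> carrier M" "n \<in> carrier N"
  shows "ract (tensor R M N) (elem_tensor R M N m n) r = elem_tensor R M N m (ract N n r)"
proof -
  interpret M: bimodule R M by fact
  interpret N: bimodule R N by fact
  let ?f = "frag_extend (\<lambda>(m, n). frag_of (m, ract N n r))"
  have rel: "?f x \<in> tensor_relators R M N" if "x \<in> tensor_relators R M N" for x
    using that assms(3) unfolding tensor_relators_def
    apply (elim UnE CollectE exE conjE)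
      apply (rule UnI1, rule UnI1)
      apply (force simp: frag_extend_diff N.ract_add_left N.ract_closed)
     apply (rule UnI1, rule UnI2)
     apply (force simp: frag_extend_diff N.ract_add_left N.ract_closed)
    apply (rule UnI2)
    apply (force simp: frag_extend_diff N.lact_ract N.ract_closed)
    done
  show ?thesis
    using tensor_class_Union[OF M N, of ?f "frag_of (m,n)"] rel assms
    by (simp add: tensor_def elem_tensor_def frag_extend_add frag_extend_minus N.ract_closed)
qed


section \<open>The semitrivial extension\<close>

definition semitrivial_extension ::
  "('k, 'c) ring_scheme \<Rightarrow> ('k, 'a, 'd) module_scheme
    \<Rightarrow> (((('a \<Rightarrow> 'k) \<times> ('a \<Rightarrow> 'k)) \<Rightarrow>\<^sub>0 int) set \<Rightarrow> 'a) \<Rightarrow> ('k, 'a \<times> ('a \<Rightarrow> 'k)) module"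
  where "semitrivial_extension K R \<psi> =
    \<lparr>carrier = carrier R \<times> carrier (dual K R),
     mult = (\<lambda>(r, f) (s, g).
       (r \<otimes>\<^bsub>R\<^esub> s \<oplus>\<^bsub>R\<^esub> \<psi> (elem_tensor R (dual K R) (dual K R) f g),
        lact (dual K R) r g \<oplus>\<^bsub>dual K R\<^esub> ract (dual K R) f s)),
     one = (\<one>\<^bsub>R\<^esub>, \<zero>\<^bsub>dual K R\<^esub>),
     ring.zero = (\<zero>\<^bsub>R\<^esub>, \<zero>\<^bsub>dual K R\<^esub>),
     add = (\<lambda>(r, f) (s, g). (r \<oplus>\<^bsub>R\<^esub> s, f \<oplus>\<^bsub>dual K R\<^esub> g)),
     smult = (\<lambda>k (r, f). (k \<odot>\<^bsub>R\<^esub> r, \<lambda>a\<in>carrier R. k \<otimes>\<^bsub>K\<^esub> f a))\<rparr>"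


section \<open>Graded algebras\<close>

text \<open>
  The direct sum decomposition is stated for an arbitrary group: every element is in a unique way a
  sum of a finitely supported family of homogeneous elements.
\<close>

locale graded_algebra = assoc_algebra K A + G?: group G
  for K :: "('k, 'c) ring_scheme" and A :: "('k, 'a, 'd) module_scheme" (structure)
    and G :: "('g, 'e) monoid_scheme" (structure) +
  fixes A_comp :: "'g \<Rightarrow> 'a set"
  assumes component_subspace: "g \<in> carrier G \<Longrightarrow> VectorSpace.subspace K (A_comp g) A"
    and direct_sum:
    "a \<in> carrier A \<Longrightarrow>
      \<exists>!x. x \<in> (\<Pi>\<^sub>E g\<in>carrier G. A_comp g) \<and> finite {g \<in> carrier G. x g \<noteq> \<zero>\<^bsub>A\<^esub>} \<and>
           a = (\<Oplus>\<^bsub>A\<^esub>g\<in>{g \<in> carrier G. x g \<noteq> \<zero>\<^bsub>A\<^esub>}. x g)"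
    and component_mult:
    "\<lbrakk>g \<in> carrier G; h \<in> carrier G; x \<in> A_comp g; y \<in> A_comp h\<rbrakk>
      \<Longrightarrow> x \<otimes>\<^bsub>A\<^esub> y \<in> A_comp (g \<otimes>\<^bsub>G\<^esub> h)"

text \<open>
  The product of two components is the additive subgroup generated by the products of their
  elements, not just the set of these products.
\<close>

locale strongly_graded_algebra = graded_algebra K A G A_comp
  for K and A (structure) and G (structure) and A_comp +
  assumes component_prod:
    "\<lbrakk>g \<in> carrier G; h \<in> carrier G\<rbrakk>
      \<Longrightarrow> generate (add_monoid A) (A_comp g <#>\<^bsub>A\<^esub> A_comp h) = A_comp (g \<otimes>\<^bsub>G\<^esub> h)"

end

theory Submission
  imports Defs
begin

text \<open>
  Write \<open>[f, g] = \<psi> (f \<otimes> g)\<close>. The only delicate part of associativity is \<open>[f, g] h = f [g, h]\<close>. As \<open>\<psi>\<close> is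
  injective and \<open>1 = \<Sum> [p\<^sub>i, q\<^sub>i]\<close>, one has \<open>g \<otimes> h = \<Sum> [g, h] p\<^sub>i \<otimes> q\<^sub>i\<close>, so \<open>[f, g] h = \<theta> (f) [g, h]\<close> for the
  right linear map \<open>\<theta> (x) = \<Sum> [x, p\<^sub>i] q\<^sub>i\<close>. Evaluating these functionals at \<open>1\<close> gives
  \<open>h ([f, g]) = \<theta> (f) ([g, h])\<close>; rotating three times, \<open>f ([g, h]) = \<theta> (f) ([\<theta> (g), \<theta> (h)])\<close>. On the
  other hand \<open>[f, g] [h, k] = [\<theta> (f), \<theta> (g)] [h, k]\<close>, whence \<open>[\<theta> (g), \<theta> (h)] = [g, h]\<close> and \<open>\<theta>\<close> is the
  identity.

  The symmetrizing form \<open>(r, f) \<mapsto> f (1)\<close> takes the value \<open>g (r) + f (s)\<close> on \<open>(r, f) (s, g)\<close>, which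
  is visibly symmetric, and nondegenerate because \<open>R\<close> is reflexive. Strong grading comes down to
  surjectivity of \<open>\<psi>\<close>.
\<close>


section \<open>The tensor product\<close>

lemma free_Abelian_group_add_closed:
  "\<lbrakk>x \<in> carrier (free_Abelian_group S); y \<in> carrier (free_Abelian_group S)\<rbrakk>
    \<Longrightarrow> x + y \<in> carrier (free_Abelian_group S)"
  by (auto dest!: subsetD[OF keys_add])

lemma free_Abelian_group_diff_closed:
  "\<lbrakk>x \<in> carrier (free_Abelian_group S); y \<in> carrier (free_Abelian_group S)\<rbrakk>
    \<Longrightarrow> x - y \<in> carrier (free_Abelian_group S)"
  by (auto dest!: subsetD[OF keys_diff])

lemma tensor_kernel_normal:
  assumes "bimodule R M" "bimodule R N"
  shows "tensor_kernel R M N \<lhd> tensor_free M N"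
proof -
  interpret F: comm_group "tensor_free M N" by (rule abelian_free_Abelian_group)
  show ?thesis
    unfolding tensor_kernel_def
    by (intro F.subgroup_imp_normal F.generate_is_subgroup tensor_relators_subset assms)
qed

lemma tensor_abelian_group:
  assumes "bimodule R M" "bimodule R N"
  shows "abelian_group (tensor R M N)"
proof -
  interpret F: comm_group "tensor_free M N" by (rule abelian_free_Abelian_group)
  interpret Q: comm_group "tensor_free M N Mod tensor_kernel R M N"
    by (intro F.abelian_FactGroup normal_imp_subgroup tensor_kernel_normal assms)
  show ?thesis
    using Q.m_closed Q.one_closed Q.m_assoc Q.m_comm Q.l_one Q.l_inv_ex
    by (intro abelian_groupI) (simp_all add: tensor_def)
qed

lemma tensor_class_closed:
  assumes "x \<in> carrier (tensor_free M N)"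
  shows "tensor_class R M N x \<in> carrier (tensor R M N)"
  using assms by (auto simp: tensor_def FactGroup_def tensor_class_def RCOSETS_def)

lemma tensor_class_add:
  assumes "bimodule R M" "bimodule R N"
    and "x \<in> carrier (tensor_free M N)" "y \<in> carrier (tensor_free M N)"
  shows "tensor_class R M N x \<oplus>\<^bsub>tensor R M N\<^esub> tensor_class R M N y = tensor_class R M N (x + y)"
proof -
  interpret N: normal "tensor_kernel R M N" "tensor_free M N"
    by (rule tensor_kernel_normal[OF assms(1,2)])
  show ?thesis
    using N.rcos_sum[OF assms(3,4)] by (simp add: tensor_def FactGroup_def tensor_class_def)
qed

lemma elem_tensor_closed:
  assumes "m \<in> carrier M" "n \<in> carrier N"
  shows "elem_tensor R M N m n \<in> carrier (tensor R M N)"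
  unfolding elem_tensor_def using assms by (intro tensor_class_closed) auto

lemma tensor_class_eqI:
  assumes "bimodule R M" "bimodule R N"
    and "x \<in> carrier (tensor_free M N)" "y \<in> carrier (tensor_free M N)"
    and "x - y \<in> tensor_kernel R M N"
  shows "tensor_class R M N x = tensor_class R M N y"
proof -
  interpret N: normal "tensor_kernel R M N" "tensor_free M N"
    by (rule tensor_kernel_normal[OF assms(1,2)])
  have "x \<in> tensor_class R M N y"
    using assms(5) unfolding tensor_class_def r_coset_def by (auto intro!: bexI[of _ "x - y"])
  then show ?thesis
    unfolding tensor_class_def
    using N.repr_independence assms(4) N.subgroup_axioms by blast
qed

lemma elem_tensor_add_left:
  assumes "bimodule R M" "bimodule R N" "m \<in> carrier M" "m' \<in> carrier M" "n \<in> carrier N"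
  shows "elem_tensor R M N (m \<oplus>\<^bsub>M\<^esub> m') n =
    elem_tensor R M N m n \<oplus>\<^bsub>tensor R M N\<^esub> elem_tensor R M N m' n"
proof -
  interpret M: bimodule R M by fact
  have "frag_of (m \<oplus>\<^bsub>M\<^esub> m', n) - frag_of (m, n) - frag_of (m', n) \<in> tensor_kernel R M N"
    unfolding tensor_kernel_def
    by (rule generate.incl) (use assms in \<open>auto simp: tensor_relators_def\<close>)
  \<comment> \<open>The relator \<open>a - b - c\<close> is read as \<open>a - (b + c)\<close>, so
    that it identifies two classes, the second of which splits as a sum.\<close>
  then show ?thesis
    unfolding elem_tensor_def
    using assms
    by (subst tensor_class_add[OF assms(1,2)])
      (simp_all add: diff_diff_add tensor_class_eqI free_Abelian_group_add_closed
        del: carrier_free_Abelian_group_iff)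
qed

lemma elem_tensor_add_right:
  assumes "bimodule R M" "bimodule R N" "m \<in> carrier M" "n \<in> carrier N" "n' \<in> carrier N"
  shows "elem_tensor R M N m (n \<oplus>\<^bsub>N\<^esub> n') =
    elem_tensor R M N m n \<oplus>\<^bsub>tensor R M N\<^esub> elem_tensor R M N m n'"
proof -
  interpret N: bimodule R N by fact
  have "frag_of (m, n \<oplus>\<^bsub>N\<^esub> n') - frag_of (m, n) - frag_of (m, n') \<in> tensor_kernel R M N"
    unfolding tensor_kernel_def
    by (rule generate.incl) (use assms in \<open>auto simp: tensor_relators_def\<close>)
  then show ?thesis
    unfolding elem_tensor_def
    using assms
    by (subst tensor_class_add[OF assms(1,2)])
      (simp_all add: diff_diff_add tensor_class_eqI free_Abelian_group_add_closed
        del: carrier_free_Abelian_group_iff)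
qed

lemma elem_tensor_balanced:
  assumes "bimodule R M" "bimodule R N" "m \<in> carrier M" "r \<in> carrier R" "n \<in> carrier N"
  shows "elem_tensor R M N (ract M m r) n = elem_tensor R M N m (lact N r n)"
proof -
  interpret M: bimodule R M by fact
  interpret N: bimodule R N by fact
  have "frag_of (ract M m r, n) - frag_of (m, lact N r n) \<in> tensor_kernel R M N"
    unfolding tensor_kernel_def
    by (rule generate.incl) (use assms in \<open>auto simp: tensor_relators_def\<close>)
  then show ?thesis
    unfolding elem_tensor_def
    by (intro tensor_class_eqI) (use assms in \<open>auto simp: M.ract_closed N.lact_closed\<close>)
qed

text \<open>Sums of elementary tensors alone exhaust the tensor product: zero is the elementary
  tensor of two zeros, and a sign is absorbed by the left factor.\<close>

lemma tensor_induct [consumes 3, case_names elem add]: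
  assumes M: "bimodule R M" and N: "bimodule R N"
    and t: "t \<in> carrier (tensor R M N)"
    and elem: "\<And>m n. \<lbrakk>m \<in> carrier M; n \<in> carrier N\<rbrakk> \<Longrightarrow> P (elem_tensor R M N m n)"
    and add: "\<And>s t. \<lbrakk>s \<in> carrier (tensor R M N); t \<in> carrier (tensor R M N); P s; P t\<rbrakk>
      \<Longrightarrow> P (s \<oplus>\<^bsub>tensor R M N\<^esub> t)"
  shows "P t"
proof -
  interpret M: bimodule R M by fact
  interpret N: bimodule R N by fact
  interpret T: abelian_group "tensor R M N" by (rule tensor_abelian_group[OF M N])
  let ?e = "elem_tensor R M N" and ?c = "tensor_class R M N"
  have e0: "?e \<zero>\<^bsub>M\<^esub> n = \<zero>\<^bsub>tensor R M N\<^esub>" if "n \<in> carrier N" for n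
    using elem_tensor_add_left[OF M N M.zero_closed M.zero_closed that]
      elem_tensor_closed[OF M.zero_closed that, of R] by simp
  have c0: "?c 0 = \<zero>\<^bsub>tensor R M N\<^esub>"
    using tensor_class_add[OF M N, of 0 0] tensor_class_closed[of 0 M N R] by simp
  \<comment> \<open>Both sides are additive inverses of the same elementary tensor.\<close>
  have neg: "?c (- frag_of (m, n)) = ?e (\<ominus>\<^bsub>M\<^esub> m) n" if "m \<in> carrier M" "n \<in> carrier N" for m n
  proof -
    have "?c (frag_of (m, n)) \<oplus>\<^bsub>tensor R M N\<^esub> ?c (- frag_of (m, n)) = \<zero>\<^bsub>tensor R M N\<^esub>"
      using that by (subst tensor_class_add[OF M N]) (auto simp: c0)
    moreover have "?c (frag_of (m, n)) \<oplus>\<^bsub>tensor R M N\<^esub> ?e (\<ominus>\<^bsub>M\<^esub> m) n = \<zero>\<^bsub>tensor R M N\<^esub>"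
      using elem_tensor_add_left[OF M N that(1) M.a_inv_closed[OF that(1)] that(2)] e0 that
      by (simp add: M.r_neg elem_tensor_def)
    moreover have "?c (frag_of (m, n)) \<in> carrier (tensor R M N)"
      "?c (- frag_of (m, n)) \<in> carrier (tensor R M N)" "?e (\<ominus>\<^bsub>M\<^esub> m) n \<in> carrier (tensor R M N)"
      using that by (auto intro!: tensor_class_closed elem_tensor_closed)
    ultimately show ?thesis
      by (metis T.add.m_comm T.minus_equality)
  qed
  obtain x where x: "Poly_Mapping.keys x \<subseteq> carrier M \<times> carrier N" "t = ?c x"
    using t by (auto simp: tensor_def FactGroup_def RCOSETS_def tensor_class_def)
  \<comment> \<open>Induction on the free abelian group passes through differences, so
    \<open>P\<close> is carried along for \<open>x\<close> and for \<open>- x\<close>.\<close>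
  have "P (?c x) \<and> P (?c (- x))"
    using x(1)
  proof (induction rule: free_Abelian_group_induct[consumes 1, case_names zero diff frag])
    case zero
    have "P (?e \<zero>\<^bsub>M\<^esub> \<zero>\<^bsub>N\<^esub>)" by (rule elem) auto
    then show ?case by (simp add: c0 e0)
  next
    case (diff x y)
    then have cl: "?c x \<in> carrier (tensor R M N)" "?c y \<in> carrier (tensor R M N)"
      "?c (- x) \<in> carrier (tensor R M N)" "?c (- y) \<in> carrier (tensor R M N)"
      by (auto intro!: tensor_class_closed)
    have "?c x \<oplus>\<^bsub>tensor R M N\<^esub> ?c (- y) = ?c (x - y)" "?c (- x) \<oplus>\<^bsub>tensor R M N\<^esub> ?c y = ?c (- (x - y))"
      using diff(1,2) by (subst tensor_class_add[OF M N]; auto)+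
    then show ?case
      using add[OF cl(1,4)] add[OF cl(3,2)] diff by simp
  next
    case (frag a)
    then obtain m n where "a = (m, n)" "m \<in> carrier M" "n \<in> carrier N" by auto
    then show ?case
      using elem[of m n] elem[of "\<ominus>\<^bsub>M\<^esub> m" n] by (simp add: neg) (simp add: elem_tensor_def)
  qed
  then show ?thesis using x(2) by simp
qed

text \<open>A balanced biadditive map extends additively to the free abelian group and kills every
  relator, hence the subgroup they generate; it then factors through the quotient.\<close>

lemma tensor_universal:
  assumes M: "bimodule R M" and N: "bimodule R N" and B: "abelian_group B"
    and closed: "\<And>m n. \<lbrakk>m \<in> carrier M; n \<in> carrier N\<rbrakk> \<Longrightarrow> b m n \<in> carrier B"
    and add_left: "\<And>m m' n. \<lbrakk>m \<in> carrier M; m' \<in> carrier M; n \<in> carrier N\<rbrakk>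
      \<Longrightarrow> b (m \<oplus>\<^bsub>M\<^esub> m') n = b m n \<oplus>\<^bsub>B\<^esub> b m' n"
    and add_right: "\<And>m n n'. \<lbrakk>m \<in> carrier M; n \<in> carrier N; n' \<in> carrier N\<rbrakk>
      \<Longrightarrow> b m (n \<oplus>\<^bsub>N\<^esub> n') = b m n \<oplus>\<^bsub>B\<^esub> b m n'"
    and balanced: "\<And>m r n. \<lbrakk>m \<in> carrier M; r \<in> carrier R; n \<in> carrier N\<rbrakk>
      \<Longrightarrow> b (ract M m r) n = b m (lact N r n)"
  obtains \<beta> where "\<And>t. t \<in> carrier (tensor R M N) \<Longrightarrow> \<beta> t \<in> carrier B"
    and "\<And>s t. \<lbrakk>s \<in> carrier (tensor R M N); t \<in> carrier (tensor R M N)\<rbrakk>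
      \<Longrightarrow> \<beta> (s \<oplus>\<^bsub>tensor R M N\<^esub> t) = \<beta> s \<oplus>\<^bsub>B\<^esub> \<beta> t"
    and "\<And>m n. \<lbrakk>m \<in> carrier M; n \<in> carrier N\<rbrakk> \<Longrightarrow> \<beta> (elem_tensor R M N m n) = b m n"
proof -
  interpret M: bimodule R M by fact
  interpret N: bimodule R N by fact
  interpret B: abelian_group B by fact
  interpret F: comm_group "tensor_free M N" by (rule abelian_free_Abelian_group)
  obtain h where h: "h \<in> hom (tensor_free M N) (add_monoid B)"
    and h_of: "\<And>x. x \<in> carrier M \<times> carrier N \<Longrightarrow> h (frag_of x) = case_prod b x"
  proof (rule comm_group.free_Abelian_group_universal[OF B.a_comm_group])
    show "case_prod b ` (carrier M \<times> carrier N) \<subseteq> carrier (add_monoid B)"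
      using closed by auto
  qed blast
  interpret h: group_hom "tensor_free M N" "add_monoid B" h
    by (intro group_hom.intro group_hom_axioms.intro h F.is_group B.a_group)
  have hdiff: "h (x - y) = h x \<ominus>\<^bsub>B\<^esub> h y"
    if "x \<in> carrier (tensor_free M N)" "y \<in> carrier (tensor_free M N)" for x y
    using h.hom_mult[of x "- y"] h.hom_inv[of y] that
    by (simp add: a_minus_def a_inv_def)
  have rel: "tensor_relators R M N \<subseteq> kernel (tensor_free M N) (add_monoid B) h"
  proof
    fix x assume x: "x \<in> tensor_relators R M N"
    then have xc: "x \<in> carrier (tensor_free M N)" using tensor_relators_subset[OF M N] by blast
    from x have "h x = \<zero>\<^bsub>B\<^esub>"
      unfolding tensor_relators_def
    proof (elim UnE CollectE exE conjE)
      fix m m' n assume "m \<in> carrier M" "m' \<in> carrier M" "n \<in> carrier N"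
        and "x = frag_of (m \<oplus>\<^bsub>M\<^esub> m', n) - frag_of (m, n) - frag_of (m', n)"
      then show ?thesis
        by (simp add: hdiff free_Abelian_group_diff_closed h_of add_left closed a_minus_def
            B.a_ac B.r_neg B.r_neg1 B.r_neg2 del: carrier_free_Abelian_group_iff)
    next
      fix m n n' assume "m \<in> carrier M" "n \<in> carrier N" "n' \<in> carrier N"
        and "x = frag_of (m, n \<oplus>\<^bsub>N\<^esub> n') - frag_of (m, n) - frag_of (m, n')"
      then show ?thesis
        by (simp add: hdiff free_Abelian_group_diff_closed h_of add_right closed a_minus_def
            B.a_ac B.r_neg B.r_neg1 B.r_neg2 del: carrier_free_Abelian_group_iff)
    next
      fix m r n assume "m \<in> carrier M" "r \<in> carrier R" "n \<in> carrier N"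
        and "x = frag_of (ract M m r, n) - frag_of (m, lact N r n)"
      then show ?thesis
        by (simp add: hdiff h_of balanced closed M.ract_closed N.lact_closed B.r_neg a_minus_def)
    qed
    then show "x \<in> kernel (tensor_free M N) (add_monoid B) h"
      using xc by (simp add: kernel_def)
  qed
  have "tensor_kernel R M N \<subseteq> kernel (tensor_free M N) (add_monoid B) h"
    unfolding tensor_kernel_def
    by (rule F.generate_subgroup_incl[OF rel h.subgroup_kernel])
  then obtain \<beta> where "\<beta> \<in> hom (tensor_free M N Mod tensor_kernel R M N) (add_monoid B)"
    and b: "\<And>x. x \<in> carrier (tensor_free M N) \<Longrightarrow> \<beta> (tensor_kernel R M N #>\<^bsub>tensor_free M N\<^esub> x) = h x"
    using h.FactGroup_universal_kernel[OF tensor_kernel_normal[OF M N]] by metis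
  then show thesis
    by (intro that[of \<beta>])
      (auto simp: tensor_def FactGroup_def hom_def elem_tensor_def tensor_class_def h_of)
qed

section \<open>A bracket on the dual\<close>

lemma dual_apply_closed: "\<lbrakk>f \<in> carrier (dual K V); x \<in> carrier V\<rbrakk> \<Longrightarrow> f x \<in> carrier K"
  by (auto simp: dual_def)

lemma dual_apply_add:
  "\<lbrakk>f \<in> carrier (dual K V); x \<in> carrier V; y \<in> carrier V\<rbrakk> \<Longrightarrow> f (x \<oplus>\<^bsub>V\<^esub> y) = f x \<oplus>\<^bsub>K\<^esub> f y"
  by (auto simp: dual_def)

lemma dual_apply_smult:
  "\<lbrakk>f \<in> carrier (dual K V); k \<in> carrier K; x \<in> carrier V\<rbrakk> \<Longrightarrow> f (k \<odot>\<^bsub>V\<^esub> x) = k \<otimes>\<^bsub>K\<^esub> f x"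
  by (auto simp: dual_def)

lemma dual_add_apply: "x \<in> carrier V \<Longrightarrow> (f \<oplus>\<^bsub>dual K V\<^esub> g) x = f x \<oplus>\<^bsub>K\<^esub> g x"
  by (simp add: dual_def)

lemma dual_zero_apply: "x \<in> carrier V \<Longrightarrow> \<zero>\<^bsub>dual K V\<^esub> x = \<zero>\<^bsub>K\<^esub>"
  by (simp add: dual_def)

lemma dual_lact_apply: "x \<in> carrier V \<Longrightarrow> lact (dual K V) r f x = f (x \<otimes>\<^bsub>V\<^esub> r)"
  by (simp add: dual_def)

lemma dual_ract_apply: "x \<in> carrier V \<Longrightarrow> ract (dual K V) f r x = f (r \<otimes>\<^bsub>V\<^esub> x)"
  by (simp add: dual_def)

lemma dual_eqI:
  assumes "f \<in> carrier (dual K V)" "g \<in> carrier (dual K V)"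
    and "\<And>x. x \<in> carrier V \<Longrightarrow> f x = g x"
  shows "f = g"
  by (rule extensionalityI[of _ "carrier V"]) (use assms in \<open>auto simp: dual_def PiE_iff\<close>)

section \<open>The pairing induced by \<open>\<psi>\<close> and its linearity over
  \<open>R\<close>\<close>

locale dual_square_iso = assoc_algebra K R
  for K :: "('k, 'x) ring_scheme" and R :: "('k, 'a, 'y) module_scheme" (structure) +
  fixes \<psi> :: "((('a \<Rightarrow> 'k) \<times> ('a \<Rightarrow> 'k)) \<Rightarrow>\<^sub>0 int) set \<Rightarrow> 'a"
  assumes psi_iso:
    "\<psi> \<in> bimodule_iso R (tensor R (dual K R) (dual K R)) (regular_bimodule R)"
begin

abbreviation D where "D \<equiv> dual K R"

abbreviation T where "T \<equiv> tensor R D D"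

definition bracket :: "('a \<Rightarrow> 'k) \<Rightarrow> ('a \<Rightarrow> 'k) \<Rightarrow> 'a"
  where "bracket f g = \<psi> (elem_tensor R D D f g)"

lemma bimodule_D: "bimodule R D"
  by (rule dual_bimodule) (rule assoc_algebra_axioms)

sublocale D: bimodule R D
  by (rule bimodule_D)

sublocale T: abelian_group T
  by (intro tensor_abelian_group bimodule_D)

lemma elem_closed: "\<lbrakk>f \<in> carrier D; g \<in> carrier D\<rbrakk> \<Longrightarrow> elem_tensor R D D f g \<in> carrier T"
  by (rule elem_tensor_closed)

lemma psi_closed: "t \<in> carrier T \<Longrightarrow> \<psi> t \<in> carrier R"
  using psi_iso by (auto simp: bimodule_iso_def bimodule_hom_def regular_bimodule_def)

lemma psi_add: "\<lbrakk>s \<in> carrier T; t \<in> carrier T\<rbrakk> \<Longrightarrow> \<psi> (s \<oplus>\<^bsub>T\<^esub> t) = \<psi> s \<oplus> \<psi> t"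
  using psi_iso by (simp add: bimodule_iso_def bimodule_hom_def regular_bimodule_def)

lemma psi_inj: "inj_on \<psi> (carrier T)"
  using psi_iso by (simp add: bimodule_iso_def bij_betw_def)

lemma psi_surj: "\<psi> ` carrier T = carrier R"
  using psi_iso by (simp add: bimodule_iso_def bij_betw_def regular_bimodule_def)

lemma bracket_closed: "\<lbrakk>f \<in> carrier D; g \<in> carrier D\<rbrakk> \<Longrightarrow> bracket f g \<in> carrier R"
  unfolding bracket_def by (intro psi_closed elem_closed)

lemma bracket_add_left:
  "\<lbrakk>f \<in> carrier D; f' \<in> carrier D; g \<in> carrier D\<rbrakk>
    \<Longrightarrow> bracket (f \<oplus>\<^bsub>D\<^esub> f') g = bracket f g \<oplus> bracket f' g"
  by (simp add: bracket_def elem_tensor_add_left[OF bimodule_D bimodule_D] psi_add elem_closed)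

lemma bracket_add_right:
  "\<lbrakk>f \<in> carrier D; g \<in> carrier D; g' \<in> carrier D\<rbrakk>
    \<Longrightarrow> bracket f (g \<oplus>\<^bsub>D\<^esub> g') = bracket f g \<oplus> bracket f g'"
  by (simp add: bracket_def elem_tensor_add_right[OF bimodule_D bimodule_D] psi_add elem_closed)

lemma bracket_balanced:
  "\<lbrakk>f \<in> carrier D; r \<in> carrier R; g \<in> carrier D\<rbrakk>
    \<Longrightarrow> bracket (ract D f r) g = bracket f (lact D r g)"
  by (simp add: bracket_def elem_tensor_balanced[OF bimodule_D bimodule_D])

lemma bracket_lact:
  assumes "r \<in> carrier R" "f \<in> carrier D" "g \<in> carrier D"
  shows "bracket (lact D r f) g = r \<otimes> bracket f g"
proof -
  have "\<psi> (lact T r (elem_tensor R D D f g)) = r \<otimes> \<psi> (elem_tensor R D D f g)"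
    using psi_iso assms elem_closed
    by (simp add: bimodule_iso_def bimodule_hom_def regular_bimodule_def)
  then show ?thesis
    using assms by (simp add: bracket_def lact_elem_tensor[OF bimodule_D bimodule_D])
qed

lemma bracket_ract:
  assumes "r \<in> carrier R" "f \<in> carrier D" "g \<in> carrier D"
  shows "bracket f (ract D g r) = bracket f g \<otimes> r"
proof -
  have "\<psi> (ract T (elem_tensor R D D f g) r) = \<psi> (elem_tensor R D D f g) \<otimes> r"
    using psi_iso assms elem_closed
    by (simp add: bimodule_iso_def bimodule_hom_def regular_bimodule_def)
  then show ?thesis
    using assms by (simp add: bracket_def ract_elem_tensor[OF bimodule_D bimodule_D])
qed

text \<open>By surjectivity of \<open>\<psi>\<close> every element of \<open>R\<close> is a finite
  sum of brackets, so an additive property may be checked on brackets. This serves the linearity of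
  the twist, the invariance of the bracket and the strong grading.\<close>

lemma bracket_induct [consumes 1, case_names bracket add]:
  assumes "r \<in> carrier R"
    and "\<And>f g. \<lbrakk>f \<in> carrier D; g \<in> carrier D\<rbrakk> \<Longrightarrow> P (bracket f g)"
    and "\<And>r s. \<lbrakk>r \<in> carrier R; s \<in> carrier R; P r; P s\<rbrakk> \<Longrightarrow> P (r \<oplus> s)"
  shows "P r"
proof -
  obtain t where t: "t \<in> carrier T" "r = \<psi> t"
    using assms(1) psi_surj by blast
  have "P (\<psi> t)"
    using bimodule_D bimodule_D t(1)
  proof (induction rule: tensor_induct)
    case (elem f g)
    then show ?case using assms(2) by (simp add: bracket_def)
  next
    case (add s t)
    then show ?case using assms(3) by (simp add: psi_add psi_closed)
  qed
  then show ?thesis using t by simp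
qed

text \<open>For fixed \<open>f\<close> the expression \<open>[f, g] h\<close> is balanced in
  \<open>g\<close> and \<open>h\<close>, so it comes from a map \<open>\<beta> f\<close> on the
  tensor product; \<open>\<theta> f\<close> is the value of that map at a preimage of
  \<open>\<one>\<close>. The result is \<open>[f, g] h = f [g, h]\<close> up to the twist
  \<open>\<theta>\<close>.\<close>

lemma bracket_lact_eq_ract_twist:
  obtains \<theta> where "\<And>f. f \<in> carrier D \<Longrightarrow> \<theta> f \<in> carrier D"
    and "\<And>f g h. \<lbrakk>f \<in> carrier D; g \<in> carrier D; h \<in> carrier D\<rbrakk>
      \<Longrightarrow> lact D (bracket f g) h = ract D (\<theta> f) (bracket g h)"
proof -
  note cl = D.lact_closed D.ract_closed bracket_closed
  have "\<forall>f\<in>carrier D. \<exists>\<beta>. (\<forall>t\<in>carrier T. \<beta> t \<in> carrier D) \<and>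
    (\<forall>s\<in>carrier T. \<forall>t\<in>carrier T. \<beta> (s \<oplus>\<^bsub>T\<^esub> t) = \<beta> s \<oplus>\<^bsub>D\<^esub> \<beta> t) \<and>
    (\<forall>g\<in>carrier D. \<forall>h\<in>carrier D. \<beta> (elem_tensor R D D g h) = lact D (bracket f g) h)"
  proof
    fix f assume f: "f \<in> carrier D"
    show "\<exists>\<beta>. (\<forall>t\<in>carrier T. \<beta> t \<in> carrier D) \<and>
      (\<forall>s\<in>carrier T. \<forall>t\<in>carrier T. \<beta> (s \<oplus>\<^bsub>T\<^esub> t) = \<beta> s \<oplus>\<^bsub>D\<^esub> \<beta> t) \<and>
      (\<forall>g\<in>carrier D. \<forall>h\<in>carrier D. \<beta> (elem_tensor R D D g h) = lact D (bracket f g) h)"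
    proof (rule tensor_universal[OF bimodule_D bimodule_D D.M.abelian_group_axioms,
            of "\<lambda>g h. lact D (bracket f g) h"])
      fix \<beta>
      assume "\<And>t. t \<in> carrier T \<Longrightarrow> \<beta> t \<in> carrier D"
        and "\<And>s t. \<lbrakk>s \<in> carrier T; t \<in> carrier T\<rbrakk> \<Longrightarrow> \<beta> (s \<oplus>\<^bsub>T\<^esub> t) = \<beta> s \<oplus>\<^bsub>D\<^esub> \<beta> t"
        and "\<And>g h. \<lbrakk>g \<in> carrier D; h \<in> carrier D\<rbrakk>
          \<Longrightarrow> \<beta> (elem_tensor R D D g h) = lact D (bracket f g) h"
      then show ?thesis by (intro exI[of _ \<beta>]) simp
    \<comment> \<open>Balancedness is
      \<open>[f, g r] h = ([f, g] r) h = [f, g] (r h)\<close>.\<close>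
    qed (auto simp: f cl bracket_add_right bracket_ract D.lact_add_left D.lact_add_right D.lact_assoc)
  qed
  from bchoice[OF this] obtain \<beta> where
    \<beta>: "\<And>f t. \<lbrakk>f \<in> carrier D; t \<in> carrier T\<rbrakk> \<Longrightarrow> \<beta> f t \<in> carrier D"
    "\<And>f s t. \<lbrakk>f \<in> carrier D; s \<in> carrier T; t \<in> carrier T\<rbrakk>
      \<Longrightarrow> \<beta> f (s \<oplus>\<^bsub>T\<^esub> t) = \<beta> f s \<oplus>\<^bsub>D\<^esub> \<beta> f t"
    "\<And>f g h. \<lbrakk>f \<in> carrier D; g \<in> carrier D; h \<in> carrier D\<rbrakk>
      \<Longrightarrow> \<beta> f (elem_tensor R D D g h) = lact D (bracket f g) h"
    by blast
  have "\<one> \<in> \<psi> ` carrier T" by (simp add: psi_surj)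
  \<comment> \<open>\<open>u\<close> is the sum of the \<open>p\<^sub>i \<otimes> q\<^sub>i\<close>
    of the overview, so \<open>\<beta> f u\<close> is the sum of the
    \<open>[f, p\<^sub>i] q\<^sub>i\<close>.\<close>
  then obtain u where u: "u \<in> carrier T" "\<psi> u = \<one>" by auto
  define \<theta> where "\<theta> f = \<beta> f u" for f
  have \<theta>_closed: "\<theta> f \<in> carrier D" if "f \<in> carrier D" for f
    unfolding \<theta>_def using that u by (simp add: \<beta>)
  \<comment> \<open>Additivity in the first argument, checked on elementary tensors; taken at
    \<open>u\<close> it becomes additivity of \<open>\<theta>\<close>.\<close>
  have "\<beta> (f \<oplus>\<^bsub>D\<^esub> f') t = \<beta> f t \<oplus>\<^bsub>D\<^esub> \<beta> f' t"
    if f: "f \<in> carrier D" "f' \<in> carrier D" and t: "t \<in> carrier T" for f f' t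
    using bimodule_D bimodule_D t
  proof (induction rule: tensor_induct)
    case (elem g h)
    then show ?case using f by (simp add: \<beta> bracket_add_left D.lact_add_left cl)
  next
    case (add s t)
    then show ?case using f by (simp add: \<beta> D.M.a_ac)
  qed
  then have \<theta>_add: "\<theta> (f \<oplus>\<^bsub>D\<^esub> f') = \<theta> f \<oplus>\<^bsub>D\<^esub> \<theta> f'" if "f \<in> carrier D" "f' \<in> carrier D" for f f'
    unfolding \<theta>_def using that u by simp
  \<comment> \<open>\<open>t'\<close> is \<open>r t\<close>; an existential avoids proving that the left action on all of \<open>T\<close> is additive.\<close>
  have shift: "\<exists>t'\<in>carrier T. \<psi> t' = r \<otimes> \<psi> t \<and> (\<forall>f\<in>carrier D. \<beta> f t' = \<beta> (ract D f r) t)"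
    if r: "r \<in> carrier R" and t: "t \<in> carrier T" for r t
    using bimodule_D bimodule_D t
  proof (induction rule: tensor_induct)
    case (elem g h)
    then show ?case
      using r
      by (intro bexI[of _ "elem_tensor R D D (lact D r g) h"])
        (auto simp: \<beta> cl bracket_balanced elem_closed bracket_lact simp flip: bracket_def)
  next
    case (add s t)
    then obtain s' t' where "s' \<in> carrier T" "\<psi> s' = r \<otimes> \<psi> s" "\<forall>f\<in>carrier D. \<beta> f s' = \<beta> (ract D f r) s"
      "t' \<in> carrier T" "\<psi> t' = r \<otimes> \<psi> t" "\<forall>f\<in>carrier D. \<beta> f t' = \<beta> (ract D f r) t" by blast
    then show ?case
      using r add.hyps
      by (intro bexI[of _ "s' \<oplus>\<^bsub>T\<^esub> t'"]) (auto simp: \<beta> cl psi_add psi_closed r_distr)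
  qed
  \<comment> \<open>For \<open>r = [g, h]\<close> the shifted \<open>u\<close> has image
    \<open>[g, h]\<close> under \<open>\<psi>\<close>, so injectivity identifies it with the
    elementary tensor of \<open>g\<close> and \<open>h\<close>, where \<open>\<beta> f\<close> is
    known.\<close>
  have *: "lact D (bracket f g) h = \<theta> (ract D f (bracket g h))"
    if fgh: "f \<in> carrier D" "g \<in> carrier D" "h \<in> carrier D" for f g h
  proof -
    obtain t where t: "t \<in> carrier T" "\<psi> t = bracket g h \<otimes> \<psi> u"
      "\<forall>f\<in>carrier D. \<beta> f t = \<beta> (ract D f (bracket g h)) u"
      using shift[OF bracket_closed u(1)] fgh by blast
    have "t = elem_tensor R D D g h"
      using psi_inj t(1,2) fgh u
      by (auto simp: inj_on_def elem_closed bracket_closed simp flip: bracket_def)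
    then show ?thesis
      using t(3) fgh by (simp add: \<beta> \<theta>_def)
  qed
  \<comment> \<open>Right linearity is proved with an extra factor \<open>s\<close>, since
    \<open>*\<close> describes \<open>\<theta>\<close> only at arguments \<open>f [g, h]\<close>.
    For \<open>s = [g, h]\<close> both sides are \<open>[f, g] (h r)\<close>; general
    \<open>s\<close> follows by additivity, and \<open>s = \<one>\<close> removes the
    factor.\<close>
  have "\<theta> (ract D f (s \<otimes> r)) = ract D (\<theta> (ract D f s)) r"
    if f: "f \<in> carrier D" and r: "r \<in> carrier R" and s: "s \<in> carrier R" for f r s
    using s
  proof (induction rule: bracket_induct)
    case (bracket g h)
    have "\<theta> (ract D f (bracket g h \<otimes> r)) = \<theta> (ract D f (bracket g (ract D h r)))"
      using f r bracket by (simp add: bracket_ract)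
    also have "\<dots> = ract D (lact D (bracket f g) h) r"
      using f r bracket by (simp add: *[symmetric] cl D.lact_ract)
    finally show ?case using f r bracket by (simp add: *)
  next
    case (add s s')
    then show ?case
      using f r by (simp add: l_distr D.ract_add_right D.ract_add_left \<theta>_add \<theta>_closed cl)
  qed
  from this[of _ _ \<one>] have "\<theta> (ract D f r) = ract D (\<theta> f) r"
    if "f \<in> carrier D" "r \<in> carrier R" for f r
    using that by (simp add: D.ract_one)
  then show thesis
    using that[of \<theta>] * \<theta>_closed bracket_closed by simp
qed

text \<open>The twist \<open>\<theta>\<close> is removed by comparing two of its effects: it
  accompanies each rotation of the arguments in \<open>h ([f, g])\<close>, and it leaves every
  bracket fixed.\<close>

lemma bracket_lact_eq_ract:
  assumes "f \<in> carrier D" "g \<in> carrier D" "h \<in> carrier D"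
  shows "lact D (bracket f g) h = ract D f (bracket g h)"
proof -
  obtain \<theta> where \<theta>: "\<And>f. f \<in> carrier D \<Longrightarrow> \<theta> f \<in> carrier D"
    and eq: "\<And>f g h. \<lbrakk>f \<in> carrier D; g \<in> carrier D; h \<in> carrier D\<rbrakk>
      \<Longrightarrow> lact D (bracket f g) h = ract D (\<theta> f) (bracket g h)"
    using bracket_lact_eq_ract_twist by blast
  \<comment> \<open>Both sides of \<open>eq\<close> are evaluated at \<open>\<one>\<close>.\<close>
  have cyc: "h (bracket f g) = \<theta> f (bracket g h)"
    if "f \<in> carrier D" "g \<in> carrier D" "h \<in> carrier D" for f g h
    using fun_cong[OF eq[OF that], of \<one>] that
    by (simp add: dual_lact_apply dual_ract_apply bracket_closed)
  \<comment> \<open>Using \<open>eq\<close> twice, \<open>[f, g] [h, k] = [\<theta> f [g, h], k] =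
    [\<theta> f, \<theta> g [h, k]]\<close>. Brackets generate \<open>R\<close> additively, so the
    right factor \<open>[h, k]\<close> may be replaced by \<open>\<one>\<close>.\<close>
  have twist_invariant: "bracket (\<theta> f) (\<theta> g) = bracket f g" if fg: "f \<in> carrier D" "g \<in> carrier D" for f g
  proof -
    have "bracket (\<theta> f) (\<theta> g) \<otimes> r = bracket f g \<otimes> r" if "r \<in> carrier R" for r
      using that
    proof (induction rule: bracket_induct)
      case (bracket h k)
      have "bracket f g \<otimes> bracket h k = bracket (ract D (\<theta> f) (bracket g h)) k"
        using fg bracket by (simp add: bracket_closed flip: bracket_lact eq)
      also have "\<dots> = bracket (\<theta> f) (ract D (\<theta> g) (bracket h k))"
        using fg bracket by (simp add: bracket_closed bracket_balanced eq \<theta>)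
      finally show ?case using fg bracket by (simp add: bracket_ract bracket_closed \<theta>)
    next
      case (add r s)
      then show ?case using fg by (simp add: r_distr bracket_closed \<theta>)
    qed
    from this[of \<one>] show ?thesis using fg by (simp add: bracket_closed \<theta>)
  qed
  have "\<theta> f r = f r" if f: "f \<in> carrier D" and r: "r \<in> carrier R" for f r
    using r
  proof (induction rule: bracket_induct)
    case (bracket g h)
    \<comment> \<open>Three rotations: \<open>f ([g, h]) = \<theta> g ([h, f]) = \<theta> h
      ([f, \<theta> g]) = \<theta> f ([\<theta> g, \<theta> h])\<close>.\<close>
    then have "f (bracket g h) = \<theta> f (bracket (\<theta> g) (\<theta> h))"
      using f by (simp add: cyc[of g h f] cyc[of h f "\<theta> g"] cyc[of f "\<theta> g" "\<theta> h"] \<theta>)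
    then show ?case using bracket by (simp add: twist_invariant)
  next
    case (add r s)
    then show ?case
      using dual_apply_add[OF f add(1,2)] dual_apply_add[OF \<theta>[OF f] add(1,2)] by metis
  qed
  then have "\<theta> f = f" if "f \<in> carrier D" for f
    using that by (intro dual_eqI[OF \<theta>]) auto
  then show ?thesis using eq assms by simp
qed

end

section \<open>Dual bases\<close>

text \<open>The record returned by \<open>dual\<close> has no field for scalars; this supplies the
  action, in agreement with the second component of \<open>smult\<close> in
  \<open>semitrivial_extension\<close>.\<close>

definition dual_smult ::
  "('k, 'c) ring_scheme \<Rightarrow> ('k, 'a, 'd) module_scheme \<Rightarrow> 'k \<Rightarrow> ('a \<Rightarrow> 'k) \<Rightarrow> ('a \<Rightarrow> 'k)"
  where "dual_smult K V k f = (\<lambda>x\<in>carrier V. k \<otimes>\<^bsub>K\<^esub> f x)"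

context vectorspace
begin

section \<open>Vector space operations on functionals\<close>

lemma dual_smult_apply: "x \<in> carrier V \<Longrightarrow> dual_smult K V k f x = k \<otimes>\<^bsub>K\<^esub> f x"
  by (simp add: dual_smult_def)

lemma dual_smult_closed:
  "\<lbrakk>k \<in> carrier K; f \<in> carrier (dual K V)\<rbrakk> \<Longrightarrow> dual_smult K V k f \<in> carrier (dual K V)"
  by (auto simp: dual_def dual_smult_def PiE_iff R.r_distr R.m_lcomm)

lemma dual_zero_closed: "\<zero>\<^bsub>dual K V\<^esub> \<in> carrier (dual K V)"
  by (auto simp: dual_def)

lemma dual_add_closed:
  "\<lbrakk>f \<in> carrier (dual K V); g \<in> carrier (dual K V)\<rbrakk> \<Longrightarrow> f \<oplus>\<^bsub>dual K V\<^esub> g \<in> carrier (dual K V)"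
  by (auto simp: dual_def PiE_iff R.r_distr R.a_ac)

lemma dual_apply_zero: "f \<in> carrier (dual K V) \<Longrightarrow> f \<zero>\<^bsub>V\<^esub> = \<zero>\<^bsub>K\<^esub>"
  using dual_apply_smult[of f K V "\<zero>\<^bsub>K\<^esub>" "\<zero>\<^bsub>V\<^esub>"] dual_apply_closed[of f K V "\<zero>\<^bsub>V\<^esub>"] by simp

lemma lincomb_insert_eq:
  assumes "finite S" "insert b S \<subseteq> carrier V" "b \<notin> S" "a \<in> insert b S \<rightarrow> carrier K"
  shows "lincomb a (insert b S) = a b \<odot>\<^bsub>V\<^esub> b \<oplus>\<^bsub>V\<^esub> lincomb a S"
  using lincomb_insert[of S a b] assms by simp

text \<open>\<open>c\<close> is the family of coordinate functionals of \<open>B\<close>. The last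
  clause, recovering the coefficients of a linear combination, stands in for linear
  independence.\<close>

definition dual_basis
  where "dual_basis B c \<longleftrightarrow>
    finite B \<and> B \<subseteq> carrier V \<and> (\<forall>b\<in>B. c b \<in> carrier (dual K V)) \<and>
    (\<forall>x\<in>carrier V. lincomb (\<lambda>b. c b x) B = x) \<and>
    (\<forall>a\<in>B \<rightarrow> carrier K. \<forall>b\<in>B. c b (lincomb a B) = a b)"

lemma dual_basisD:
  assumes "dual_basis B c"
  shows "finite B" "B \<subseteq> carrier V" "\<And>b. b \<in> B \<Longrightarrow> c b \<in> carrier (dual K V)"
    and "\<And>x. x \<in> carrier V \<Longrightarrow> lincomb (\<lambda>b. c b x) B = x"
    and "\<And>a b. \<lbrakk>a \<in> B \<rightarrow> carrier K; b \<in> B\<rbrakk> \<Longrightarrow> c b (lincomb a B) = a b"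
  using assms by (simp_all add: dual_basis_def)

lemma dual_basis_exists:
  assumes "fin_dim"
  shows "\<exists>B c. dual_basis B c"
proof -
  obtain B where B: "finite B" "basis B"
    using finite_basis_exists[OF assms] by blast
  then have BV: "B \<subseteq> carrier V" by (simp add: basis_def)
  have ex1: "\<exists>!a. a \<in> B \<rightarrow>\<^sub>E carrier K \<and> lincomb a B = v" if "v \<in> carrier V" for v
    using basis_criterion[OF B(1) BV] B(2) that by blast
  \<comment> \<open>Coefficient functions are unique only when fixed to \<open>undefined\<close> off
    \<open>B\<close>, hence the extensional function space here and the \<open>restrict\<close>
    below.\<close>
  define coord where "coord v = (THE a. a \<in> B \<rightarrow>\<^sub>E carrier K \<and> lincomb a B = v)" for v
  have coord: "coord v \<in> B \<rightarrow>\<^sub>E carrier K" "lincomb (coord v) B = v" if "v \<in> carrier V" for v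
    using theI'[OF ex1[OF that]] by (simp_all add: coord_def)
  have coord_lincomb: "coord (lincomb a B) b = a b" if a: "a \<in> B \<rightarrow> carrier K" and b: "b \<in> B" for a b
  proof -
    have l: "lincomb (restrict a B) B = lincomb a B"
      by (rule lincomb_cong) (use a BV in auto)
    have "restrict a B \<in> B \<rightarrow>\<^sub>E carrier K" using a by auto
    then have "coord (lincomb a B) = restrict a B"
      using ex1[of "lincomb a B"] coord[of "lincomb a B"] l a BV by (metis lincomb_closed)
    then show ?thesis using b by simp
  qed
  have coord_closed: "coord x b \<in> carrier K" if "x \<in> carrier V" "b \<in> B" for x b
    using coord(1)[OF that(1)] that(2) by auto
  define c where "c b = (\<lambda>x\<in>carrier V. coord x b)" for b
  \<comment> \<open>Linearity by uniqueness: the sums of the coordinates are coefficients of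
    \<open>x \<oplus> y\<close>, hence its coordinates. Scalars are treated alike.\<close>
  have coord_add: "coord (x \<oplus>\<^bsub>V\<^esub> y) b = coord x b \<oplus>\<^bsub>K\<^esub> coord y b"
    if "x \<in> carrier V" "y \<in> carrier V" "b \<in> B" for x y b
  proof -
    have "lincomb (\<lambda>b. coord x b \<oplus>\<^bsub>K\<^esub> coord y b) B =
        (\<Oplus>\<^bsub>V\<^esub>b\<in>B. coord x b \<odot>\<^bsub>V\<^esub> b \<oplus>\<^bsub>V\<^esub> coord y b \<odot>\<^bsub>V\<^esub> b)"
      unfolding lincomb_def
      by (rule M.finsum_cong') (use that(1,2) BV coord_closed in \<open>auto simp: smult_l_distr\<close>)
    also have "\<dots> = lincomb (coord x) B \<oplus>\<^bsub>V\<^esub> lincomb (coord y) B"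
      unfolding lincomb_def
      by (rule M.finsum_addf) (use that(1,2) BV coord_closed in auto)
    also have "\<dots> = x \<oplus>\<^bsub>V\<^esub> y"
      using coord(2) that(1,2) by simp
    finally show ?thesis
      using coord_lincomb[of "\<lambda>b. coord x b \<oplus>\<^bsub>K\<^esub> coord y b" b] that coord_closed by (simp add: Pi_iff)
  qed
  have coord_smult: "coord (k \<odot>\<^bsub>V\<^esub> x) b = k \<otimes>\<^bsub>K\<^esub> coord x b"
    if "x \<in> carrier V" "k \<in> carrier K" "b \<in> B" for x k b
    using coord_lincomb[of "\<lambda>b. k \<otimes>\<^bsub>K\<^esub> coord x b" b] lincomb_smult[OF BV, of "coord x" k]
      coord(2)[OF that(1)] that coord_closed by (simp add: Pi_iff)
  have "dual_basis B c"
    unfolding dual_basis_def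
  proof (intro conjI ballI B(1) BV)
    show "c b \<in> carrier (dual K V)" if "b \<in> B" for b
      using that coord_closed by (auto simp: dual_def c_def coord_add coord_smult)
    show "lincomb (\<lambda>b. c b x) B = x" if "x \<in> carrier V" for x
      using coord[OF that] that by (simp add: c_def)
    show "c b (lincomb a B) = a b" if "a \<in> B \<rightarrow> carrier K" "b \<in> B" for a b
      using that BV coord_lincomb by (simp add: c_def lincomb_closed)
  qed
  then show ?thesis by blast
qed

lemma lincomb_induct:
  assumes "finite B" "B \<subseteq> carrier V" "a \<in> B \<rightarrow> carrier K"
    and "P \<zero>\<^bsub>V\<^esub>"
    and "\<And>x y. \<lbrakk>x \<in> carrier V; y \<in> carrier V; P x; P y\<rbrakk> \<Longrightarrow> P (x \<oplus>\<^bsub>V\<^esub> y)"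
    and "\<And>k b. \<lbrakk>k \<in> carrier K; b \<in> B\<rbrakk> \<Longrightarrow> P (k \<odot>\<^bsub>V\<^esub> b)"
  shows "P (lincomb a B)"
  using assms(1-3,6)
proof (induction B rule: finite_induct)
  case empty
  then show ?case using assms(4) by (simp add: lincomb_def)
next
  case (insert b B)
  have "lincomb a (insert b B) = a b \<odot>\<^bsub>V\<^esub> b \<oplus>\<^bsub>V\<^esub> lincomb a B"
    using insert.hyps insert.prems by (intro lincomb_insert_eq)
  moreover have "P (a b \<odot>\<^bsub>V\<^esub> b \<oplus>\<^bsub>V\<^esub> lincomb a B)"
  proof (rule assms(5))
    show "P (a b \<odot>\<^bsub>V\<^esub> b)" using insert.prems by (intro insert.prems(3)) auto
    show "P (lincomb a B)" using insert.prems by (intro insert.IH) auto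
    show "lincomb a B \<in> carrier V" using insert.prems by (intro lincomb_closed) auto
    show "a b \<odot>\<^bsub>V\<^esub> b \<in> carrier V" using insert.prems by (intro smult_closed) auto
  qed
  ultimately show ?case by simp
qed

text \<open>The coordinate functionals span the dual, because \<open>f\<close> is the sum over
  \<open>B\<close> of the multiples of \<open>c b\<close> by \<open>f b\<close>.\<close>

lemma dual_basis_induct:
  assumes dual_basis: "dual_basis B c" and f: "f \<in> carrier (dual K V)"
    and zero: "P \<zero>\<^bsub>dual K V\<^esub>"
    and add: "\<And>f g. \<lbrakk>f \<in> carrier (dual K V); g \<in> carrier (dual K V); P f; P g\<rbrakk>
      \<Longrightarrow> P (f \<oplus>\<^bsub>dual K V\<^esub> g)"
    and smult: "\<And>k b. \<lbrakk>k \<in> carrier K; b \<in> B\<rbrakk> \<Longrightarrow> P (dual_smult K V k (c b))"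
  shows "P f"
proof -
  note B = dual_basisD[OF dual_basis]
  \<comment> \<open>This functional is the partial sum over \<open>S\<close> of the multiples of
    \<open>c b\<close> by \<open>f b\<close>; it is zero for \<open>S = {}\<close> and
    \<open>f\<close> for \<open>S = B\<close>.\<close>
  have "(\<lambda>x\<in>carrier V. f (lincomb (\<lambda>b. c b x) S)) \<in> carrier (dual K V) \<and>
      P (\<lambda>x\<in>carrier V. f (lincomb (\<lambda>b. c b x) S))" if "S \<subseteq> B" for S
    using finite_subset[OF that B(1)] that
  proof (induction S rule: finite_induct)
    case empty
    have "(\<lambda>x\<in>carrier V. f (lincomb (\<lambda>b. c b x) {})) = \<zero>\<^bsub>dual K V\<^esub>"
      using f by (simp add: lincomb_def dual_def dual_apply_zero[OF f])
    then show ?case using zero dual_zero_closed by simp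
  next
    case (insert b S)
    let ?g = "\<lambda>S. \<lambda>x\<in>carrier V. f (lincomb (\<lambda>b. c b x) S)"
    have b: "b \<in> B" "b \<in> carrier V" "S \<subseteq> carrier V" using insert B(2) by auto
    have cc: "\<And>b x. \<lbrakk>b \<in> B; x \<in> carrier V\<rbrakk> \<Longrightarrow> c b x \<in> carrier K"
      using dual_apply_closed[OF B(3)] .
    have fb: "f b \<in> carrier K" using dual_apply_closed[OF f b(2)] .
    have "f (lincomb (\<lambda>b. c b x) (insert b S)) = f b \<otimes>\<^bsub>K\<^esub> c b x \<oplus>\<^bsub>K\<^esub> f (lincomb (\<lambda>b. c b x) S)"
      if x: "x \<in> carrier V" for x
    proof -
      have l: "lincomb (\<lambda>b. c b x) S \<in> carrier V"
        using cc x b insert.prems by (intro lincomb_closed) auto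
      have "lincomb (\<lambda>b. c b x) (insert b S) = c b x \<odot>\<^bsub>V\<^esub> b \<oplus>\<^bsub>V\<^esub> lincomb (\<lambda>b. c b x) S"
        using insert b cc x by (intro lincomb_insert_eq) auto
      then show ?thesis
        using dual_apply_add[OF f smult_closed[OF cc[OF b(1) x] b(2)] l]
          dual_apply_smult[OF f cc[OF b(1) x] b(2)] R.m_comm[OF fb cc[OF b(1) x]] by simp
    qed
    then have eq: "?g (insert b S) = dual_smult K V (f b) (c b) \<oplus>\<^bsub>dual K V\<^esub> ?g S"
      by (auto simp: dual_def dual_smult_def)
    have IH: "?g S \<in> carrier (dual K V)" "P (?g S)"
      using insert.IH insert.prems by blast+
    have cb: "dual_smult K V (f b) (c b) \<in> carrier (dual K V)"
      using B(3) b fb by (simp add: dual_smult_closed)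
    show ?case
      unfolding eq by (rule conjI[OF dual_add_closed[OF cb IH(1)] add[OF cb IH(1) smult[OF fb b(1)] IH(2)]])
  qed
  from this[of B] have "P (\<lambda>x\<in>carrier V. f (lincomb (\<lambda>b. c b x) B))" by simp
  also have "(\<lambda>x\<in>carrier V. f (lincomb (\<lambda>b. c b x) B)) = f"
    by (rule ext) (use f B(4) in \<open>auto simp: dual_def PiE_iff extensional_def\<close>)
  finally show ?thesis .
qed

text \<open>The coordinates of \<open>v\<close> are values of functionals at \<open>v\<close>, so
  all of them vanish.\<close>

lemma dual_separates:
  assumes "fin_dim" "v \<in> carrier V" "\<And>f. f \<in> carrier (dual K V) \<Longrightarrow> f v = \<zero>\<^bsub>K\<^esub>"
  shows "v = \<zero>\<^bsub>V\<^esub>"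
proof -
  obtain B c where dual_basis: "dual_basis B c"
    using dual_basis_exists[OF assms(1)] by blast
  note B = dual_basisD[OF dual_basis]
  have "lincomb (\<lambda>b. c b v) B = lincomb (\<lambda>_. \<zero>\<^bsub>K\<^esub>) B"
    by (rule lincomb_cong) (use B assms in auto)
  also have "\<dots> = \<zero>\<^bsub>V\<^esub>"
    using B(1,2) lincomb_smult[of B "\<lambda>_. \<zero>\<^bsub>K\<^esub>" "\<zero>\<^bsub>K\<^esub>"] by simp
  finally show ?thesis using B(4) assms(2) by simp
qed

text \<open>The vector with coordinates \<open>F (c b)\<close> represents \<open>F\<close> on each
  coordinate functional, and these span the dual. This is surjectivity of the map from
  \<open>V\<close> to its bidual.\<close>

lemma dual_reflexive:
  assumes fd: "fin_dim"
    and closed: "\<And>f. f \<in> carrier (dual K V) \<Longrightarrow> F f \<in> carrier K"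
    and add: "\<And>f g. \<lbrakk>f \<in> carrier (dual K V); g \<in> carrier (dual K V)\<rbrakk>
      \<Longrightarrow> F (f \<oplus>\<^bsub>dual K V\<^esub> g) = F f \<oplus>\<^bsub>K\<^esub> F g"
    and smult: "\<And>k f. \<lbrakk>k \<in> carrier K; f \<in> carrier (dual K V)\<rbrakk>
      \<Longrightarrow> F (dual_smult K V k f) = k \<otimes>\<^bsub>K\<^esub> F f"
  obtains v where "v \<in> carrier V" "\<And>f. f \<in> carrier (dual K V) \<Longrightarrow> F f = f v"
proof -
  obtain B c where dual_basis: "dual_basis B c"
    using dual_basis_exists[OF fd] by blast
  note B = dual_basisD[OF dual_basis]
  define v where "v = lincomb (\<lambda>b. F (c b)) B"
  have v: "v \<in> carrier V"
    unfolding v_def using B closed by (intro lincomb_closed) auto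
  have F0: "F \<zero>\<^bsub>dual K V\<^esub> = \<zero>\<^bsub>K\<^esub>"
  proof -
    have "dual_smult K V \<zero>\<^bsub>K\<^esub> \<zero>\<^bsub>dual K V\<^esub> = \<zero>\<^bsub>dual K V\<^esub>"
      by (auto simp: dual_smult_def dual_def)
    then show ?thesis
      using smult[OF R.zero_closed dual_zero_closed] closed[OF dual_zero_closed] by simp
  qed
  have "F f = f v" if "f \<in> carrier (dual K V)" for f
    using dual_basis that
  proof (rule dual_basis_induct)
    show "F \<zero>\<^bsub>dual K V\<^esub> = \<zero>\<^bsub>dual K V\<^esub> v"
      using v by (simp add: F0 dual_zero_apply)
    show "F (f \<oplus>\<^bsub>dual K V\<^esub> g) = (f \<oplus>\<^bsub>dual K V\<^esub> g) v"
      if "f \<in> carrier (dual K V)" "g \<in> carrier (dual K V)" "F f = f v" "F g = g v" for f g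
      using that v by (simp add: add dual_add_apply)
    show "F (dual_smult K V k (c b)) = dual_smult K V k (c b) v" if "k \<in> carrier K" "b \<in> B" for k b
    proof -
      have "c b v = F (c b)" unfolding v_def using that B closed by (intro B(5)) auto
      then show ?thesis using that v B(3) by (simp add: smult dual_smult_apply)
    qed
  qed
  then show thesis using v that by blast
qed

end

section \<open>The algebra structure and its trace form\<close>

context dual_square_iso
begin

section \<open>Component formulas and the ring laws of the extension\<close>

abbreviation A where "A \<equiv> semitrivial_extension K R \<psi>"

lemma carrier_A: "carrier A = carrier R \<times> carrier D"
  by (simp add: semitrivial_extension_def)

lemma mult_A:
  "(r, f) \<otimes>\<^bsub>A\<^esub> (s, g) = (r \<otimes> s \<oplus> bracket f g, lact D r g \<oplus>\<^bsub>D\<^esub> ract D f s)"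
  by (simp add: semitrivial_extension_def bracket_def)

lemma one_A: "\<one>\<^bsub>A\<^esub> = (\<one>, \<zero>\<^bsub>D\<^esub>)"
  by (simp add: semitrivial_extension_def)

lemma zero_A: "\<zero>\<^bsub>A\<^esub> = (\<zero>, \<zero>\<^bsub>D\<^esub>)"
  by (simp add: semitrivial_extension_def)

lemma add_A: "(r, f) \<oplus>\<^bsub>A\<^esub> (s, g) = (r \<oplus> s, f \<oplus>\<^bsub>D\<^esub> g)"
  by (simp add: semitrivial_extension_def)

lemma smult_A: "k \<odot>\<^bsub>A\<^esub> (r, f) = (k \<odot> r, dual_smult K R k f)"
  by (simp add: semitrivial_extension_def dual_smult_def)

lemmas A_simps = carrier_A mult_A one_A zero_A add_A smult_A

lemma lact_zero_left: "f \<in> carrier D \<Longrightarrow> lact D \<zero> f = \<zero>\<^bsub>D\<^esub>"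
  using D.lact_add_left[of \<zero> \<zero> f] D.lact_closed[of \<zero> f] by simp

lemma lact_zero_right: "r \<in> carrier R \<Longrightarrow> lact D r \<zero>\<^bsub>D\<^esub> = \<zero>\<^bsub>D\<^esub>"
  using D.lact_add_right[of r "\<zero>\<^bsub>D\<^esub>" "\<zero>\<^bsub>D\<^esub>"] D.lact_closed[of r "\<zero>\<^bsub>D\<^esub>"] by simp

lemma ract_zero_left: "r \<in> carrier R \<Longrightarrow> ract D \<zero>\<^bsub>D\<^esub> r = \<zero>\<^bsub>D\<^esub>"
  using D.ract_add_left[of r "\<zero>\<^bsub>D\<^esub>" "\<zero>\<^bsub>D\<^esub>"] D.ract_closed[of r "\<zero>\<^bsub>D\<^esub>"] by simp

lemma ract_zero_right: "f \<in> carrier D \<Longrightarrow> ract D f \<zero> = \<zero>\<^bsub>D\<^esub>"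
  using D.ract_add_right[of \<zero> \<zero> f] D.ract_closed[of \<zero> f] by simp

lemma bracket_zero_left: "f \<in> carrier D \<Longrightarrow> bracket \<zero>\<^bsub>D\<^esub> f = \<zero>"
  using bracket_add_left[of "\<zero>\<^bsub>D\<^esub>" "\<zero>\<^bsub>D\<^esub>" f] bracket_closed[of "\<zero>\<^bsub>D\<^esub>" f] by simp

lemma bracket_zero_right: "f \<in> carrier D \<Longrightarrow> bracket f \<zero>\<^bsub>D\<^esub> = \<zero>"
  using bracket_add_right[of f "\<zero>\<^bsub>D\<^esub>" "\<zero>\<^bsub>D\<^esub>"] bracket_closed[of f "\<zero>\<^bsub>D\<^esub>"] by simp

lemmas D_closed = D.lact_closed D.ract_closed bracket_closed

lemmas D_zero = lact_zero_left lact_zero_right ract_zero_left ract_zero_right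
  bracket_zero_left bracket_zero_right

text \<open>After expanding both triple products, the bimodule laws and the rules for the bracket
  match all terms except \<open>[f, g] h\<close> and \<open>f [g, h]\<close> in the dual component;
  these agree by \<open>bracket_lact_eq_ract\<close>.\<close>

lemma ring_A: "ring A"
proof (rule ringI)
  show "abelian_group A"
  proof (rule abelian_groupI)
    fix x assume x: "x \<in> carrier A"
    then show "\<exists>y\<in>carrier A. y \<oplus>\<^bsub>A\<^esub> x = \<zero>\<^bsub>A\<^esub>"
      by (intro bexI[of _ "(\<ominus> fst x, \<ominus>\<^bsub>D\<^esub> snd x)"]) (auto simp: A_simps l_neg D.M.l_neg)
  qed (auto simp: A_simps a_ac D.M.a_ac)
  show "monoid A"
  proof
    fix x y z assume "x \<in> carrier A" "y \<in> carrier A" "z \<in> carrier A"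
    then obtain r f s g t h where xyz: "x = (r, f)" "y = (s, g)" "z = (t, h)"
      and cl: "r \<in> carrier R" "s \<in> carrier R" "t \<in> carrier R"
        "f \<in> carrier D" "g \<in> carrier D" "h \<in> carrier D"
      by (auto simp: carrier_A)
    show "x \<otimes>\<^bsub>A\<^esub> y \<otimes>\<^bsub>A\<^esub> z = x \<otimes>\<^bsub>A\<^esub> (y \<otimes>\<^bsub>A\<^esub> z)"
      using cl unfolding xyz
      by (simp add: A_simps D_closed l_distr r_distr bracket_add_left bracket_add_right
          bracket_lact bracket_ract bracket_balanced bracket_lact_eq_ract D.lact_add_left
          D.lact_add_right D.ract_add_left D.ract_add_right D.lact_assoc D.ract_assoc
          D.lact_ract m_assoc a_ac D.M.a_ac)
  qed (auto simp: A_simps D_closed D_zero D.lact_one D.ract_one)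
qed (auto simp: A_simps D_closed l_distr r_distr bracket_add_left bracket_add_right
    D.lact_add_left D.lact_add_right D.ract_add_left D.ract_add_right a_ac D.M.a_ac)

text \<open>The field acts through the elements \<open>k \<odot> \<one>\<close> of \<open>R\<close>,
  which turns laws about scalars into bimodule laws.\<close>

lemma dual_smult_eq_lact:
  "\<lbrakk>k \<in> carrier K; f \<in> carrier D\<rbrakk> \<Longrightarrow> dual_smult K R k f = lact D (k \<odot> \<one>) f"
  by (rule ext) (auto simp: dual_def dual_smult_def smult_mult_right)

lemma dual_smult_eq_ract:
  "\<lbrakk>k \<in> carrier K; f \<in> carrier D\<rbrakk> \<Longrightarrow> dual_smult K R k f = ract D f (k \<odot> \<one>)"
  by (rule ext) (auto simp: dual_def dual_smult_def smult_mult_left)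

text \<open>The hypothesis on \<open>\<psi>\<close> speaks of sums and of the actions of
  \<open>R\<close>; compatibility of the bracket with \<open>K\<close> is derived from the action of
  \<open>k \<odot> \<one>\<close> on either side.\<close>

lemma dual_smult_compat:
  assumes "k \<in> carrier K" "r \<in> carrier R" "f \<in> carrier D" "g \<in> carrier D"
  shows "lact D (k \<odot> r) f = dual_smult K R k (lact D r f)"
    and "lact D r (dual_smult K R k f) = dual_smult K R k (lact D r f)"
    and "ract D f (k \<odot> r) = dual_smult K R k (ract D f r)"
    and "ract D (dual_smult K R k f) r = dual_smult K R k (ract D f r)"
    and "bracket (dual_smult K R k f) g = k \<odot> bracket f g"
    and "bracket f (dual_smult K R k g) = k \<odot> bracket f g"
proof -
  have k: "k \<odot> \<one> \<in> carrier R" and kr: "k \<odot> r = (k \<odot> \<one>) \<otimes> r" "k \<odot> r = r \<otimes> (k \<odot> \<one>)"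
    using assms by (simp_all add: smult_mult_left smult_mult_right)
  show "lact D (k \<odot> r) f = dual_smult K R k (lact D r f)"
    using assms k by (simp add: kr(1) dual_smult_eq_lact D_closed D.lact_assoc)
  \<comment> \<open>The scalar is written as a right action so that it commutes with the left action
    of \<open>r\<close>; the mirror case below uses the left form.\<close>
  show "lact D r (dual_smult K R k f) = dual_smult K R k (lact D r f)"
    using assms k by (simp add: dual_smult_eq_ract D_closed D.lact_ract)
  show "ract D f (k \<odot> r) = dual_smult K R k (ract D f r)"
    using assms k by (simp add: kr(2) dual_smult_eq_ract D_closed D.ract_assoc)
  show "ract D (dual_smult K R k f) r = dual_smult K R k (ract D f r)"
    using assms k by (simp add: dual_smult_eq_lact D_closed D.lact_ract)
  show "bracket (dual_smult K R k f) g = k \<odot> bracket f g"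
    using assms k by (simp add: dual_smult_eq_lact bracket_lact bracket_closed smult_mult_left)
  show "bracket f (dual_smult K R k g) = k \<odot> bracket f g"
    using assms k by (simp add: dual_smult_eq_ract bracket_ract bracket_closed smult_mult_right)
qed

lemma dual_smult_module:
  assumes "k \<in> carrier K" "l \<in> carrier K" "f \<in> carrier D" "g \<in> carrier D"
  shows "dual_smult K R (k \<oplus>\<^bsub>K\<^esub> l) f = dual_smult K R k f \<oplus>\<^bsub>D\<^esub> dual_smult K R l f"
    and "dual_smult K R k (f \<oplus>\<^bsub>D\<^esub> g) = dual_smult K R k f \<oplus>\<^bsub>D\<^esub> dual_smult K R k g"
    and "dual_smult K R (k \<otimes>\<^bsub>K\<^esub> l) f = dual_smult K R k (dual_smult K R l f)"
  using assms
  by (simp_all add: dual_smult_eq_lact smult_l_distr D.lact_add_left D.lact_add_right D_closed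
      smult_assoc1 smult_mult_left flip: D.lact_assoc)

lemma dual_smult_one: "f \<in> carrier D \<Longrightarrow> dual_smult K R \<one>\<^bsub>K\<^esub> f = f"
  by (simp add: dual_smult_eq_lact D.lact_one)

lemma assoc_algebra_A: "assoc_algebra K A"
proof -
  interpret A: ring A by (rule ring_A)
  have "module K A"
    by (rule moduleI[OF R.is_cring A.is_abelian_group])
      (auto simp: A_simps dual_smult_closed dual_smult_module dual_smult_one smult_l_distr smult_r_distr smult_assoc1)
  then have "vectorspace K A"
    by (intro vectorspace.intro field_axioms)
  then show ?thesis
    by (intro assoc_algebra.intro assoc_algebra_axioms.intro ring_A)
      (auto simp: A_simps dual_smult_closed dual_smult_module dual_smult_compat D_closed
        smult_mult_left smult_mult_right smult_r_distr)
qed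

sublocale A: assoc_algebra K A
  by (rule assoc_algebra_A)

section \<open>The symmetrizing form\<close>

definition trace_form :: "'a \<times> ('a \<Rightarrow> 'k) \<Rightarrow> 'k"
  where "trace_form x = snd x \<one>"

text \<open>Only the second component of the product is evaluated, so the bracket does not enter,
  and the two actions evaluated at \<open>\<one>\<close> give \<open>g r\<close> and
  \<open>f s\<close>.\<close>

lemma trace_form_mult:
  "\<lbrakk>(r, f) \<in> carrier A; (s, g) \<in> carrier A\<rbrakk> \<Longrightarrow> trace_form ((r, f) \<otimes>\<^bsub>A\<^esub> (s, g)) = g r \<oplus>\<^bsub>K\<^esub> f s"
  by (simp add: trace_form_def A_simps dual_add_apply dual_lact_apply dual_ract_apply)

lemma trace_form_commute:
  "\<lbrakk>x \<in> carrier A; y \<in> carrier A\<rbrakk> \<Longrightarrow> trace_form (x \<otimes>\<^bsub>A\<^esub> y) = trace_form (y \<otimes>\<^bsub>A\<^esub> x)"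
  by (cases x; cases y)
    (auto simp: trace_form_mult carrier_A intro!: R.a_comm dual_apply_closed[where V = R])

lemma trace_form_closed: "x \<in> carrier A \<Longrightarrow> trace_form x \<in> carrier K"
  using dual_apply_closed[OF _ one_closed] by (auto simp: trace_form_def A_simps)

lemma trace_form_add: "trace_form (x \<oplus>\<^bsub>A\<^esub> y) = trace_form x \<oplus>\<^bsub>K\<^esub> trace_form y"
  by (cases x; cases y) (simp add: trace_form_def A_simps dual_add_apply)

lemma trace_form_smult: "trace_form (k \<odot>\<^bsub>A\<^esub> x) = k \<otimes>\<^bsub>K\<^esub> trace_form x"
  by (cases x) (simp add: trace_form_def A_simps dual_smult_apply)

end

section \<open>Finite dimension and symmetry of the extension\<close>

locale fin_dim_dual_square_iso = dual_square_iso K R \<psi> + fin_dim_algebra K R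
  for K and R (structure) and \<psi>
begin

text \<open>A basis of \<open>R\<close> in the first component and its coordinate functionals in the
  second together span \<open>A\<close>.\<close>

lemma fin_dim_A: "A.fin_dim"
proof -
  obtain B c where dual_basis: "dual_basis B c"
    using dual_basis_exists[OF finite_dimensional] by blast
  note B = dual_basisD[OF dual_basis]
  let ?S = "(\<lambda>b. (b, \<zero>\<^bsub>D\<^esub>)) ` B \<union> (\<lambda>b. (\<zero>, c b)) ` B"
  have S: "?S \<subseteq> carrier A" using B by (auto simp: carrier_A)
  interpret S: submodule K "A.span ?S" A by (rule A.span_is_submodule[OF S])
  have mem: "?S \<subseteq> A.span ?S" by (rule A.in_own_span[OF S])
  have zero: "dual_smult K R k \<zero>\<^bsub>D\<^esub> = \<zero>\<^bsub>D\<^esub>" if "k \<in> carrier K" for k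
    using that by (simp add: dual_smult_eq_lact lact_zero_right)
  have R: "(x, \<zero>\<^bsub>D\<^esub>) \<in> A.span ?S" if x: "x \<in> carrier R" for x
  proof -
    have "(lincomb (\<lambda>b. c b x) B, \<zero>\<^bsub>D\<^esub>) \<in> A.span ?S"
    proof (rule lincomb_induct[OF B(1,2)])
      show "(\<lambda>b. c b x) \<in> B \<rightarrow> carrier K" using B(3) x by (auto intro: dual_apply_closed)
      show "(\<zero>, \<zero>\<^bsub>D\<^esub>) \<in> A.span ?S" using S.zero_closed by (simp add: zero_A)
      show "(y \<oplus> z, \<zero>\<^bsub>D\<^esub>) \<in> A.span ?S"
        if "(y, \<zero>\<^bsub>D\<^esub>) \<in> A.span ?S" "(z, \<zero>\<^bsub>D\<^esub>) \<in> A.span ?S" for y z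
        using S.m_closed[OF that] by (simp add: add_A)
      show "(k \<odot> b, \<zero>\<^bsub>D\<^esub>) \<in> A.span ?S" if "k \<in> carrier K" "b \<in> B" for k b
        using S.smult_closed[OF that(1), of "(b, \<zero>\<^bsub>D\<^esub>)"] that mem by (auto simp: smult_A zero)
    qed
    then show ?thesis using B(4)[OF x] by simp
  qed
  have D: "(\<zero>, f) \<in> A.span ?S" if f: "f \<in> carrier D" for f
    using dual_basis f
  proof (rule dual_basis_induct)
    show "(\<zero>, \<zero>\<^bsub>D\<^esub>) \<in> A.span ?S" using S.zero_closed by (simp add: zero_A)
    show "(\<zero>, f \<oplus>\<^bsub>D\<^esub> g) \<in> A.span ?S"
      if "(\<zero>, f) \<in> A.span ?S" "(\<zero>, g) \<in> A.span ?S" for f g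
      using S.m_closed[OF that] by (simp add: add_A)
    show "(\<zero>, dual_smult K R k (c b)) \<in> A.span ?S" if "k \<in> carrier K" "b \<in> B" for k b
      using S.smult_closed[OF that(1), of "(\<zero>, c b)"] that mem by (auto simp: smult_A)
  qed
  have "carrier A \<subseteq> A.span ?S"
  proof
    fix x assume "x \<in> carrier A"
    then show "x \<in> A.span ?S"
      using S.m_closed[OF R D, of "fst x" "snd x"] by (cases x) (simp add: A_simps)
  qed
  then have "A.span ?S = carrier A" using S.subset by blast
  then show ?thesis unfolding A.fin_dim_def using B(1) S by (intro exI[of _ ?S]) auto
qed

text \<open>The isomorphism sends \<open>x\<close> to \<open>y \<mapsto> trace_form (x y)\<close>.
  Injectivity rests on \<open>dual_separates\<close> and surjectivity on
  \<open>dual_reflexive\<close>, both applied to \<open>R\<close>.\<close>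

lemma symmetric_A: "symmetric_algebra K A"
proof -
  define \<Phi> where "\<Phi> x = (\<lambda>y\<in>carrier A. trace_form (x \<otimes>\<^bsub>A\<^esub> y))" for x
  have \<Phi>_apply: "\<Phi> (r, f) (s, g) = g r \<oplus>\<^bsub>K\<^esub> f s"
    if "r \<in> carrier R" "f \<in> carrier D" "s \<in> carrier R" "g \<in> carrier D" for r f s g
    using that by (simp add: \<Phi>_def trace_form_mult carrier_A)
  note tr = trace_form_closed trace_form_add trace_form_smult
  have closed: "\<Phi> x \<in> carrier (dual K A)" if "x \<in> carrier A" for x
    using that by (auto simp: dual_def \<Phi>_def tr A.r_distr A.smult_mult_right)
  have hom: "\<Phi> \<in> bimodule_hom A (regular_bimodule A) (dual K A)"
    unfolding bimodule_hom_def
  proof (intro CollectI conjI ballI)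
    show "\<Phi> \<in> carrier (regular_bimodule A) \<rightarrow> carrier (dual K A)"
      using closed by (simp add: regular_bimodule_def)
  next
    fix x y assume "x \<in> carrier (regular_bimodule A)" "y \<in> carrier (regular_bimodule A)"
    then have xy: "x \<in> carrier A" "y \<in> carrier A" by (simp_all add: regular_bimodule_def)
    then have "\<Phi> (x \<oplus>\<^bsub>A\<^esub> y) = \<Phi> x \<oplus>\<^bsub>dual K A\<^esub> \<Phi> y"
      by (intro ext) (simp add: dual_def \<Phi>_def A.l_distr tr)
    then show "\<Phi> (x \<oplus>\<^bsub>regular_bimodule A\<^esub> y) = \<Phi> x \<oplus>\<^bsub>dual K A\<^esub> \<Phi> y"
      by (simp add: regular_bimodule_def)
  next
    fix a x assume "a \<in> carrier A" "x \<in> carrier (regular_bimodule A)"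
    then have ax: "a \<in> carrier A" "x \<in> carrier A" by (simp_all add: regular_bimodule_def)
    have "\<Phi> (a \<otimes>\<^bsub>A\<^esub> x) = lact (dual K A) a (\<Phi> x)"
    proof
      fix y
      \<comment> \<open>Left linearity uses the symmetry of the form, which moves \<open>a\<close>
        from the front to the end; right linearity below is associativity.\<close>
      have "trace_form (a \<otimes>\<^bsub>A\<^esub> x \<otimes>\<^bsub>A\<^esub> y) = trace_form (x \<otimes>\<^bsub>A\<^esub> (y \<otimes>\<^bsub>A\<^esub> a))" if "y \<in> carrier A"
        using ax that trace_form_commute[of a "x \<otimes>\<^bsub>A\<^esub> y"] by (simp add: A.m_assoc)
      then show "\<Phi> (a \<otimes>\<^bsub>A\<^esub> x) y = lact (dual K A) a (\<Phi> x) y"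
        using ax by (simp add: dual_def \<Phi>_def)
    qed
    then show "\<Phi> (lact (regular_bimodule A) a x) = lact (dual K A) a (\<Phi> x)"
      by (simp add: regular_bimodule_def)
    have "\<Phi> (x \<otimes>\<^bsub>A\<^esub> a) = ract (dual K A) (\<Phi> x) a"
      using ax by (intro ext) (simp add: dual_def \<Phi>_def A.m_assoc)
    then show "\<Phi> (ract (regular_bimodule A) x a) = ract (dual K A) (\<Phi> x) a"
      by (simp add: regular_bimodule_def)
  qed
  have "inj_on \<Phi> (carrier A)"
  proof (rule inj_onI)
    fix x y assume "x \<in> carrier A" "y \<in> carrier A" and eq: "\<Phi> x = \<Phi> y"
    then obtain r f s g where x: "x = (r, f)" "r \<in> carrier R" "f \<in> carrier D"
      and y: "y = (s, g)" "s \<in> carrier R" "g \<in> carrier D"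
      by (auto simp: carrier_A)
    \<comment> \<open>With \<open>h\<close> zero this compares \<open>f\<close> and
      \<open>g\<close>; with \<open>t\<close> zero it compares the values of each functional at
      \<open>r\<close> and \<open>s\<close>.\<close>
    have ev: "h r \<oplus>\<^bsub>K\<^esub> f t = h s \<oplus>\<^bsub>K\<^esub> g t" if "t \<in> carrier R" "h \<in> carrier D" for t h
      using fun_cong[OF eq, of "(t, h)"] x y that by (simp add: \<Phi>_apply)
    have "f t = g t" if "t \<in> carrier R" for t
      using ev[OF that D.M.zero_closed] x y that dual_apply_closed[OF x(3) that]
        dual_apply_closed[OF y(3) that] by (simp add: dual_zero_apply)
    then have "f = g" using x y by (intro dual_eqI) auto
    have "h (r \<ominus> s) = \<zero>\<^bsub>K\<^esub>" if h: "h \<in> carrier D" for h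
    proof -
      have hs: "h r = h s"
        using ev[OF zero_closed h] x y h by (simp add: dual_apply_zero dual_apply_closed)
      have "h (r \<ominus> s) \<oplus>\<^bsub>K\<^esub> h s = h r"
        using dual_apply_add[OF h minus_closed[OF x(2) y(2)] y(2)] x y
        by (simp add: a_minus_def a_assoc l_neg)
      then show ?thesis
        using hs dual_apply_closed[OF h y(2)] dual_apply_closed[OF h minus_closed[OF x(2) y(2)]]
        by (metis R.add.l_cancel_one R.a_comm R.zero_closed)
    qed
    then have "r \<ominus> s = \<zero>" using dual_separates[OF finite_dimensional] x y by simp
    moreover have "r = (r \<ominus> s) \<oplus> s" using x y by (simp add: a_minus_def a_assoc l_neg)
    ultimately have "r = s" using x y by simp
    then show "x = y" using x y \<open>f = g\<close> by simp
  qed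
  moreover have "\<Phi> ` carrier A = carrier (dual K A)"
  proof
    show "carrier (dual K A) \<subseteq> \<Phi> ` carrier A"
    proof
      fix F assume F: "F \<in> carrier (dual K A)"
      \<comment> \<open>\<open>\<Phi> (r, f)\<close> takes the value \<open>g r\<close> at
        \<open>(\<zero>, g)\<close> and \<open>f s\<close> at the pair of \<open>s\<close> and the
        zero functional. So \<open>r\<close> comes from reflexivity of \<open>R\<close>, and
        \<open>f\<close> is the restriction of \<open>F\<close> to the first component.\<close>
      obtain r where r: "r \<in> carrier R" and Fr: "\<And>g. g \<in> carrier D \<Longrightarrow> F (\<zero>, g) = g r"
      proof (rule dual_reflexive[OF finite_dimensional, of "\<lambda>g. F (\<zero>, g)"])
        fix g assume g: "g \<in> carrier D"
        show "F (\<zero>, g) \<in> carrier K" using F g by (auto simp: dual_def carrier_A)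
        show "F (\<zero>, g \<oplus>\<^bsub>D\<^esub> h) = F (\<zero>, g) \<oplus>\<^bsub>K\<^esub> F (\<zero>, h)" if "h \<in> carrier D" for h
          using dual_apply_add[OF F, of "(\<zero>, g)" "(\<zero>, h)"] g that by (simp add: A_simps)
        show "F (\<zero>, dual_smult K R k g) = k \<otimes>\<^bsub>K\<^esub> F (\<zero>, g)" if "k \<in> carrier K" for k
          using dual_apply_smult[OF F, of k "(\<zero>, g)"] g that by (simp add: A_simps)
      qed blast
      define f where "f = (\<lambda>s\<in>carrier R. F (s, \<zero>\<^bsub>D\<^esub>))"
      have f: "f \<in> carrier D"
      proof -
        have "F (s \<oplus> t, \<zero>\<^bsub>D\<^esub>) = F (s, \<zero>\<^bsub>D\<^esub>) \<oplus>\<^bsub>K\<^esub> F (t, \<zero>\<^bsub>D\<^esub>)" if "s \<in> carrier R" "t \<in> carrier R" for s t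
          using dual_apply_add[OF F, of "(s, \<zero>\<^bsub>D\<^esub>)" "(t, \<zero>\<^bsub>D\<^esub>)"] that by (simp add: A_simps)
        moreover have "F (k \<odot> s, \<zero>\<^bsub>D\<^esub>) = k \<otimes>\<^bsub>K\<^esub> F (s, \<zero>\<^bsub>D\<^esub>)" if "k \<in> carrier K" "s \<in> carrier R" for k s
          using dual_apply_smult[OF F, of k "(s, \<zero>\<^bsub>D\<^esub>)"] that
          by (simp add: A_simps dual_smult_eq_lact lact_zero_right)
        moreover have "F (s, \<zero>\<^bsub>D\<^esub>) \<in> carrier K" if "s \<in> carrier R" for s
          using dual_apply_closed[OF F, of "(s, \<zero>\<^bsub>D\<^esub>)"] that by (simp add: A_simps)
        ultimately show ?thesis by (auto simp: dual_def f_def)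
      qed
      have "F = \<Phi> (r, f)"
      proof (rule dual_eqI[OF F closed])
        show "(r, f) \<in> carrier A" using r f by (simp add: carrier_A)
        fix y assume "y \<in> carrier A"
        then obtain s g where y: "y = (s, g)" "s \<in> carrier R" "g \<in> carrier D"
          by (auto simp: carrier_A)
        then show "F y = \<Phi> (r, f) y"
          using dual_apply_add[OF F, of "(\<zero>, g)" "(s, \<zero>\<^bsub>D\<^esub>)"] r f Fr[OF y(3)]
          by (simp add: \<Phi>_apply A_simps f_def)
      qed
      then show "F \<in> \<Phi> ` carrier A" using r f by (auto simp: carrier_A)
    qed
  qed (use closed in blast)
  ultimately have "\<Phi> \<in> bimodule_iso A (regular_bimodule A) (dual K A)"
    using hom by (simp add: bimodule_iso_def bij_betw_def regular_bimodule_def)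
  then show ?thesis
    unfolding symmetric_algebra_def
    by (intro conjI exI[of _ \<Phi>] fin_dim_algebra.intro assoc_algebra_A fin_dim_algebra_axioms.intro fin_dim_A)
qed

end

section \<open>The grading\<close>

text \<open>Negation is the action of \<open>\<ominus> \<one>\<close>. The lemma is for bounding the
  subgroup generated by products of components.\<close>

lemma (in module) submodule_imp_subgroup:
  assumes "submodule R N M"
  shows "subgroup N (add_monoid M)"
proof -
  interpret N: submodule R N M by fact
  show ?thesis
  proof (rule M.add.subgroupI)
    fix x
    assume x: "x \<in> N"
    then have "\<ominus>\<^bsub>M\<^esub> x = (\<ominus>\<^bsub>R\<^esub> \<one>\<^bsub>R\<^esub>) \<odot>\<^bsub>M\<^esub> x"
      using N.subset by (auto simp: smult_l_minus)
    then show "\<ominus>\<^bsub>M\<^esub> x \<in> N" using x by simp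
  qed (use N.subset N.zero_closed N.m_closed in blast)+
qed

context dual_square_iso
begin

lemma subspace_A:
  "subspace K (carrier R \<times> {\<zero>\<^bsub>D\<^esub>}) A" "subspace K ({\<zero>} \<times> carrier D) A"
  by (auto intro!: subspace.intro submodule.intro A.vectorspace_axioms A.module_axioms
      simp: A_simps dual_smult_closed dual_smult_eq_lact D_closed lact_zero_right)

text \<open>The unit of \<open>A\<close> lies in the component of \<open>e\<close>, which settles
  every product involving that component; for the other component times itself, strong grading is
  surjectivity of \<open>\<psi>\<close>.\<close>

lemma strongly_graded_A:
  fixes G :: "('g, 'z) monoid_scheme" (structure)
  assumes "group G" and carrier_G: "carrier G = {e, c}" and e: "e = \<one>\<^bsub>G\<^esub>" and ce: "c \<noteq> e"
  shows "strongly_graded_algebra K A G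
    (\<lambda>g. if g = e then carrier R \<times> {\<zero>\<^bsub>D\<^esub>} else {\<zero>\<^bsub>R\<^esub>} \<times> carrier D)"
    (is "strongly_graded_algebra K A G ?comp")
proof -
  interpret G: group G by fact
  have G_mult: "e \<otimes>\<^bsub>G\<^esub> e = e" "e \<otimes>\<^bsub>G\<^esub> c = c" "c \<otimes>\<^bsub>G\<^esub> e = c" "c \<otimes>\<^bsub>G\<^esub> c = e"
  proof -
    have ec: "e \<in> carrier G" "c \<in> carrier G" by (simp_all add: carrier_G)
    show "e \<otimes>\<^bsub>G\<^esub> e = e" "e \<otimes>\<^bsub>G\<^esub> c = c" "c \<otimes>\<^bsub>G\<^esub> e = c"
      using ec by (simp_all add: e)
    \<comment> \<open>Otherwise cancellation would give \<open>c = e\<close>.\<close>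
    have "c \<otimes>\<^bsub>G\<^esub> c \<noteq> c"
      using ec ce G.l_cancel_one[of c c] by (auto simp: e)
    then show "c \<otimes>\<^bsub>G\<^esub> c = e"
      using G.m_closed[OF ec(2) ec(2)] by (auto simp: carrier_G)
  qed
  have sub: "subspace K (?comp g) A" for g
    using subspace_A by simp
  \<comment> \<open>Passing to the support drops only zero terms, so the sum runs over both group
    elements; it determines the family, which gives uniqueness below.\<close>
  have decomp: "(\<Oplus>\<^bsub>A\<^esub>g\<in>{g \<in> carrier G. x g \<noteq> \<zero>\<^bsub>A\<^esub>}. x g) = (fst (x e), snd (x c))"
    if x: "x \<in> (\<Pi>\<^sub>E g\<in>carrier G. ?comp g)" for x
  proof -
    have xe: "x e \<in> carrier R \<times> {\<zero>\<^bsub>D\<^esub>}" and xc: "x c \<in> {\<zero>} \<times> carrier D"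
      using PiE_mem[OF x, of e] PiE_mem[OF x, of c] ce by (simp_all add: carrier_G)
    then have xA: "x e \<in> carrier A" "x c \<in> carrier A" by (auto simp: carrier_A)
    have "(\<Oplus>\<^bsub>A\<^esub>g\<in>{g \<in> carrier G. x g \<noteq> \<zero>\<^bsub>A\<^esub>}. x g) = (\<Oplus>\<^bsub>A\<^esub>g\<in>{e, c}. x g)"
      by (rule A.add.finprod_mono_neutral_cong_left) (use xA in \<open>auto simp: carrier_G\<close>)
    also have "\<dots> = x e \<oplus>\<^bsub>A\<^esub> x c"
      using ce xA by simp
    also have "\<dots> = (fst (x e), snd (x c))"
      using xe xc by (auto simp: A_simps)
    finally show ?thesis .
  qed
  have ds: "\<exists>!x. x \<in> (\<Pi>\<^sub>E g\<in>carrier G. ?comp g) \<and> finite {g \<in> carrier G. x g \<noteq> \<zero>\<^bsub>A\<^esub>} \<and>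
      a = (\<Oplus>\<^bsub>A\<^esub>g\<in>{g \<in> carrier G. x g \<noteq> \<zero>\<^bsub>A\<^esub>}. x g)" if a: "a \<in> carrier A" for a
  proof -
    obtain r f where rf: "a = (r, f)" "r \<in> carrier R" "f \<in> carrier D"
      using a by (auto simp: carrier_A)
    let ?x = "\<lambda>g\<in>carrier G. if g = e then (r, \<zero>\<^bsub>D\<^esub>) else (\<zero>, f)"
    have x: "?x \<in> (\<Pi>\<^sub>E g\<in>carrier G. ?comp g)"
      using rf by auto
    show ?thesis
    proof (rule ex1I[of _ ?x])
      show "?x \<in> (\<Pi>\<^sub>E g\<in>carrier G. ?comp g) \<and> finite {g \<in> carrier G. ?x g \<noteq> \<zero>\<^bsub>A\<^esub>} \<and>
        a = (\<Oplus>\<^bsub>A\<^esub>g\<in>{g \<in> carrier G. ?x g \<noteq> \<zero>\<^bsub>A\<^esub>}. ?x g)"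
        unfolding decomp[OF x] using x ce rf by (simp add: carrier_G)
    next
      fix y assume y: "y \<in> (\<Pi>\<^sub>E g\<in>carrier G. ?comp g) \<and> finite {g \<in> carrier G. y g \<noteq> \<zero>\<^bsub>A\<^esub>} \<and>
        a = (\<Oplus>\<^bsub>A\<^esub>g\<in>{g \<in> carrier G. y g \<noteq> \<zero>\<^bsub>A\<^esub>}. y g)"
      then have yP: "y \<in> (\<Pi>\<^sub>E g\<in>carrier G. ?comp g)" by blast
      have ya: "a = (fst (y e), snd (y c))" using y decomp[OF yP] by simp
      have "y e \<in> carrier R \<times> {\<zero>\<^bsub>D\<^esub>}" "y c \<in> {\<zero>} \<times> carrier D"
        using PiE_mem[OF yP, of e] PiE_mem[OF yP, of c] ce by (simp_all add: carrier_G)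
      then have "y e = (r, \<zero>\<^bsub>D\<^esub>)" "y c = (\<zero>, f)"
        using ya rf by (auto simp: prod_eq_iff)
      then show "y = ?x"
        using ce by (intro extensionalityI[of _ "carrier G"]) (use yP in \<open>auto simp: PiE_iff carrier_G\<close>)
    qed
  qed
  have comp_mult: "x \<otimes>\<^bsub>A\<^esub> y \<in> ?comp (g \<otimes>\<^bsub>G\<^esub> h)"
    if gh: "g \<in> carrier G" "h \<in> carrier G" and mem: "x \<in> ?comp g" "y \<in> ?comp h" for g h x y
  proof -
    obtain r f s f' where xy: "x = (r, f)" "y = (s, f')"
      and cl: "r \<in> carrier R" "f \<in> carrier D" "s \<in> carrier R" "f' \<in> carrier D"
      using mem by (auto split: if_splits)
    consider "g = e" "h = e" | "g = e" "h = c" | "g = c" "h = e" | "g = c" "h = c"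
      using gh by (auto simp: carrier_G)
    then show ?thesis
      using mem cl ce unfolding xy mult_A
      by cases (simp_all add: G_mult D_closed D_zero)
  qed
  have gen: "?comp (g \<otimes>\<^bsub>G\<^esub> h) \<subseteq> generate (add_monoid A) (?comp g <#>\<^bsub>A\<^esub> ?comp h)"
    if gh: "g \<in> carrier G" "h \<in> carrier G" for g h
  proof
    fix x assume x: "x \<in> ?comp (g \<otimes>\<^bsub>G\<^esub> h)"
    have prod: "y \<otimes>\<^bsub>A\<^esub> z \<in> generate (add_monoid A) (?comp g <#>\<^bsub>A\<^esub> ?comp h)"
      if "y \<in> ?comp g" "z \<in> ?comp h" for y z
      unfolding set_mult_def using that by (intro generate.incl) blast
    \<comment> \<open>In the first two cases, the first with either value of \<open>g\<close>,
      \<open>x\<close> is its own product with the unit of \<open>A\<close>.\<close>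
    consider "h = e" | "g = e" "h = c" | "g = c" "h = c" using gh by (auto simp: carrier_G)
    then show "x \<in> generate (add_monoid A) (?comp g <#>\<^bsub>A\<^esub> ?comp h)"
    proof cases
      case 1
      then have "g \<otimes>\<^bsub>G\<^esub> h = g" using gh(1) e by simp
      then have "x \<in> ?comp g" using x by simp
      moreover from this have "x \<in> carrier A" by (auto simp: carrier_A split: if_splits)
      ultimately show ?thesis
        using prod[of x "\<one>\<^bsub>A\<^esub>"] 1 by (simp add: one_A A.r_one[unfolded one_A])
    next
      case 2
      then have "x \<in> ?comp h" using x ce by (simp add: G_mult)
      moreover from this have "x \<in> carrier A" by (auto simp: carrier_A split: if_splits)
      ultimately show ?thesis
        using prod[of "\<one>\<^bsub>A\<^esub>" x] 2 by (simp add: one_A A.l_one[unfolded one_A])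
    next
      case 3
      then obtain r where r: "r \<in> carrier R" "x = (r, \<zero>\<^bsub>D\<^esub>)" using x by (auto simp: G_mult)
      \<comment> \<open>The pair of \<open>[f, f']\<close> and the zero functional is the product of
        \<open>(\<zero>, f)\<close> and \<open>(\<zero>, f')\<close>, and \<open>r\<close> is a sum
        of such brackets.\<close>
      from r(1) have "(r, \<zero>\<^bsub>D\<^esub>) \<in> generate (add_monoid A) (?comp g <#>\<^bsub>A\<^esub> ?comp h)"
      proof (induction rule: bracket_induct)
        case (bracket f f')
        then show ?case
          using prod[of "(\<zero>, f)" "(\<zero>, f')"] 3 ce by (simp add: A_simps D_zero bracket_closed)
      next
        case (add r s)
        then show ?case
          using generate.eng[OF add(3,4)] by (simp add: add_A)
      qed
      then show ?thesis using r by simp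
    qed
  qed
  show ?thesis
  proof (intro strongly_graded_algebra.intro graded_algebra.intro assoc_algebra_A G.is_group
      graded_algebra_axioms.intro strongly_graded_algebra_axioms.intro sub ds comp_mult equalityI gen)
    fix g h assume gh: "g \<in> carrier G" "h \<in> carrier G"
    \<comment> \<open>A component is an additive subgroup containing the products, hence also the
      subgroup they generate.\<close>
    have "subgroup (?comp (g \<otimes>\<^bsub>G\<^esub> h)) (add_monoid A)"
      by (intro A.submodule_imp_subgroup) (use sub in \<open>simp only: subspace_def\<close>)
    moreover have "?comp g <#>\<^bsub>A\<^esub> ?comp h \<subseteq> ?comp (g \<otimes>\<^bsub>G\<^esub> h)"
      unfolding set_mult_def using comp_mult[OF gh] by blast
    ultimately show "generate (add_monoid A) (?comp g <#>\<^bsub>A\<^esub> ?comp h) \<subseteq> ?comp (g \<otimes>\<^bsub>G\<^esub> h)"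
      by (intro A.add.generate_subgroup_incl)
  qed
qed

end

theorem proposition7p6:
  fixes K :: "('k, 'x) ring_scheme"
    and R :: "('k, 'a, 'y) module_scheme"
    and \<psi> :: "((('a \<Rightarrow> 'k) \<times> ('a \<Rightarrow> 'k)) \<Rightarrow>\<^sub>0 int) set \<Rightarrow> 'a"
    and C\<^sub>2 :: "('g, 'z) monoid_scheme"
    and e c :: 'g
  assumes "fin_dim_algebra K R"
    and "\<psi> \<in> bimodule_iso R (tensor R (dual K R) (dual K R)) (regular_bimodule R)"
    and "group C\<^sub>2" and "carrier C\<^sub>2 = {e, c}" and "e = \<one>\<^bsub>C\<^sub>2\<^esub>" and "c \<noteq> e"
  shows "assoc_algebra K (semitrivial_extension K R \<psi>) \<and>
    symmetric_algebra K (semitrivial_extension K R \<psi>) \<and>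
    strongly_graded_algebra K (semitrivial_extension K R \<psi>) C\<^sub>2
      (\<lambda>g. if g = e then carrier R \<times> {\<zero>\<^bsub>dual K R\<^esub>} else {\<zero>\<^bsub>R\<^esub>} \<times> carrier (dual K R))"
proof -
  interpret R: fin_dim_algebra K R by fact
  interpret fin_dim_dual_square_iso K R \<psi>
    by unfold_locales fact
  show ?thesis
    using assoc_algebra_A symmetric_A strongly_graded_A[OF assms(3-6)] by blast
qed

end
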